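(* Assume $\hat{\mathbb P}_x=\mathcal N(\hat\mu_x,\hat\Sigma_x)$ and $\hat{\mathbb P}_w=\mathcal N(\hat\mu_w,\hat\Sigma_w)$. Then $\sup_{\mathbb Q\in\mathbb B_{\mathcal N}(\hat{\mathbb P})}\inf_{\psi\in\mathcal F}\mathcal R(\psi,\mathbb Q)$ equals the optimal value of $$\begin{array}{cl}\sup & \mathrm{Tr}\big[\Sigma_x-\Sigma_xH^\top(H\Sigma_xH^\top+\Sigma_w)^{-1}H\Sigma_x\big]\\ \text{s.t.} & \Sigma_x\in\mathbb S^n_+,\ \Sigma_w\in\mathbb S^m_{++},\\ & \mathrm{Tr}[\Sigma_x+\hat\Sigma_x-2(\hat\Sigma_x^{1/2}\Sigma_x\hat\Sigma_x^{1/2})^{1/2}]\le\rho_x^2,\\ & \mathrm{Tr}[\Sigma_w+\hat\Sigma_w-2(\hat\Sigma_w^{1/2}\Sigma_w\hat\Sigma_w^{1/2})^{1/2}]\le\rho_w^2.\end{array}\qquad(\ast\ast)$$ If moreover $\hat\Sigma_w\succ0$, then $(\ast\ast)$ is solvable, it has a maximizer $(\Sigma_x^\star,\Sigma_w^\star)$ with $\Sigma_x^\star\succeq\lambda_{\min}(\hat\Sigma_x)I_n$ and $\Sigma_w^\star\succeq\lambda_{\min}(\hat\Sigma_w)I_m$, and for any maximizer $(\Sigma_x^\star,\Sigma_w^\star)$ of $(\ast\ast)$ the supremum over $\mathbb B_{\mathcal N}(\hat{\mathbb P})$ is attained by $\mathbb Q^\star=\mathcal N(\hat\mu_x,\Sigma_x^\star)\times\mathcal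 N(\hat\mu_w,\Sigma_w^\star)$.
   Context: Standing setup. Fix $n,m\in\mathbb N$ and $H\in\mathbb R^{m\times n}$. For $d\in\mathbb N$, $\mathcal M(\mathbb R^d)$ is the set of Borel probability distributions on $\mathbb R^d$ with finite second moments; $\mathbb W$ is the type-2 Wasserstein distance $\mathbb W(\mathbb Q_1,\mathbb Q_2)=\inf_{\pi\in\Pi(\mathbb Q_1,\mathbb Q_2)}(\int\|\xi_1-\xi_2\|^2d\pi)^{1/2}$ over couplings. $\mathcal N(\mu,\Sigma)$ denotes the (possibly degenerate) normal distribution with mean $\mu$ and covariance $\Sigma\in\mathbb S^d_+$. The signal $x\in\mathbb R^n$ and noise $w\in\mathbb R^m$ have joint distribution $\mathbb Q$; $\mathcal F$ is the set of measurable $\psi:\mathbb R^m\to\mathbb R^n$ with $\|\psi(y)\|\le C(1+\|y\|)$ for some $C>0$; $\mathcal R(\psi,\mathbb Q)=\mathbb E_{\mathbb Q}[\|x-\psi(Hx+w)\|^2]$. The nominal distribution is $\hat{\mathbb P}=\hat{\mathbb P}_x\times\hat{\mathbb P}_w$ with means $\hat\mu_x,\hat\mu_w$ and covariances $\hat\Sigma_x\in\mathbb S^n_+,\hat\Sigma_w\in\mathbb S^m_+$; radii $\rho_x,\rho_w\ge0$. The restricted normal ambiguity set is $\mathbb B_{\mathcal N}(\hat{\mathbb P})=\{\mathcal N(\hat\mu_x,\Sigma_x)\times\mathcal N(\hat\mu_w,\Sigma_w):\Sigma_x\in\mathbb S^n_+,\ \Sigma_w\in\mathbb S^m_{++},\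 \mathbb W(\mathcal N(\hat\mu_x,\Sigma_x),\hat{\mathbb P}_x)\le\rho_x,\ \mathbb W(\mathcal N(\hat\mu_w,\Sigma_w),\hat{\mathbb P}_w)\le\rho_w\}$. $\mathbb S^d_{++}$ denotes positive definite matrices and $\lambda_{\min}$ the smallest eigenvalue. *)

theory Defs
  imports "HOL-Analysis.Analysis" "HOL-Probability.Probability"
begin

definition psd_mat :: "real^'d^'d \<Rightarrow> bool" where
  "psd_mat A \<longleftrightarrow> transpose A = A \<and> (\<forall>v. 0 \<le> v \<bullet> (A *v v))"

definition pd_mat :: "real^'d^'d \<Rightarrow> bool" where
  "pd_mat A \<longleftrightarrow> transpose A = A \<and> (\<forall>v. v \<noteq> 0 \<longrightarrow> 0 < v \<bullet> (A *v v))"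

definition loewner_ge :: "real^'d^'d \<Rightarrow> real^'d^'d \<Rightarrow> bool" where
  "loewner_ge A B \<longleftrightarrow> psd_mat (A - B)"

definition msqrt :: "real^'d^'d \<Rightarrow> real^'d^'d" where
  "msqrt A = (THE R. psd_mat R \<and> R ** R = A)"

text \<open>Smallest eigenvalue (of a symmetric matrix, whose eigenvalues are real).\<close>
definition lambda_min :: "real^'d^'d \<Rightarrow> real" where
  "lambda_min A = Min {l. \<exists>v. v \<noteq> 0 \<and> A *v v = l *\<^sub>R v}"

definition std_gauss :: "(real^'d) measure" where
  "std_gauss = density lborel (\<lambda>z. ennreal (\<Prod>i\<in>UNIV. std_normal_density (z $ i)))"

text \<open>The (possibly degenerate) normal distribution N(mu, Sigma): the law of mu + Sigma^(1/2) Z.\<close>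
definition gauss :: "real^'d \<Rightarrow> real^'d^'d \<Rightarrow> (real^'d) measure" where
  "gauss mu S = distr std_gauss borel (\<lambda>z. mu + msqrt S *v z)"

definition couplings :: "(real^'d) measure \<Rightarrow> (real^'d) measure \<Rightarrow> ((real^'d) \<times> (real^'d)) measure set" where
  "couplings Q1 Q2 = {\<pi>. prob_space \<pi> \<and> sets \<pi> = sets borel \<and>
      distr \<pi> borel fst = Q1 \<and> distr \<pi> borel snd = Q2}"

definition wasserstein2 :: "(real^'d) measure \<Rightarrow> (real^'d) measure \<Rightarrow> real" where
  "wasserstein2 Q1 Q2 =
     sqrt (enn2real (INF \<pi>\<in>couplings Q1 Q2. \<integral>\<^sup>+ p. ennreal ((norm (fst p - snd p))\<^sup>2) \<partial>\<pi>))"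

definition estimators :: "(real^'m \<Rightarrow> real^'n) set" where
  "estimators = {\<psi>. \<psi> \<in> borel_measurable borel \<and>
      (\<exists>C>0. \<forall>y. norm (\<psi> y) \<le> C * (1 + norm y))}"

text \<open>Mean squared error of estimator psi under joint law Q of (x, w), observation y = Hx + w.\<close>
definition mse :: "real^'n^'m \<Rightarrow> (real^'m \<Rightarrow> real^'n) \<Rightarrow> ((real^'n) \<times> (real^'m)) measure \<Rightarrow> real" where
  "mse H \<psi> Q = (\<integral>p. (norm (fst p - \<psi> (H *v fst p + snd p)))\<^sup>2 \<partial>Q)"

definition normal_ambiguity_set ::
  "real^'n \<Rightarrow> real^'n^'n \<Rightarrow> real^'m \<Rightarrow> real^'m^'m \<Rightarrow> real \<Rightarrow> real \<Rightarrow> ((real^'n) \<times> (real^'m)) measure set" where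
  "normal_ambiguity_set mux Sx0 muw Sw0 rx rw =
     {gauss mux Sx \<Otimes>\<^sub>M gauss muw Sw | Sx Sw.
        psd_mat Sx \<and> pd_mat Sw \<and>
        wasserstein2 (gauss mux Sx) (gauss mux Sx0) \<le> rx \<and>
        wasserstein2 (gauss muw Sw) (gauss muw Sw0) \<le> rw}"

definition mmse_obj :: "real^'n^'m \<Rightarrow> real^'n^'n \<Rightarrow> real^'m^'m \<Rightarrow> real" where
  "mmse_obj H Sx Sw = trace (Sx - Sx ** transpose H ** matrix_inv (H ** Sx ** transpose H + Sw) ** H ** Sx)"

definition gelbrich_sq :: "real^'d^'d \<Rightarrow> real^'d^'d \<Rightarrow> real" where
  "gelbrich_sq S S0 = trace (S + S0 - 2 *\<^sub>R msqrt (msqrt S0 ** S ** msqrt S0))"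

definition feasible ::
  "real^'n^'n \<Rightarrow> real^'m^'m \<Rightarrow> real \<Rightarrow> real \<Rightarrow> ((real^'n^'n) \<times> (real^'m^'m)) set" where
  "feasible Sx0 Sw0 rx rw = {(Sx, Sw). psd_mat Sx \<and> pd_mat Sw \<and>
      gelbrich_sq Sx Sx0 \<le> rx\<^sup>2 \<and> gelbrich_sq Sw Sw0 \<le> rw\<^sup>2}"

end

theory Submission
  imports Defs
begin

text \<open>
  Writing \<open>R\<close> for the square root of \<open>S0\<close>, the Gelbrich distance is the Frobenius distance
  from \<open>R\<close> to the set of all \<open>X\<close> with \<open>X X\<^sup>T = S\<close>, a minimum attained at
  \<open>X = S\<^sup>1\<^sup>/\<^sup>2 K\<close> for an orthogonal \<open>K\<close>. The law of \<open>(mu + X Z, mu + R Z)\<close> with \<open>Z\<close> standard normal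
  is then an optimal coupling, and the lower bound on the transport cost follows from
  \<open>2 \<langle>x, y\<rangle> \<le> \<langle>y, T y\<rangle> + \<langle>x, T\<inverse> x\<rangle>\<close> by optimising over \<open>T\<close>. Hence the feasible set is a
  continuous image of a product of Frobenius balls.

  For normal laws the linear estimator with the usual gain is optimal: a reflection, under which the
  standard normal law is invariant, fixes the observation and flips the sign of the error. The
  minimal error is an infimum of functions that are linear and monotone in the covariances, so it
  is upper semicontinuous and monotone in the Loewner order. Every element of a Gelbrich ball
  around \<open>S0\<close> is dominated by an element of the ball that is at least \<open>lambda_min S0\<close> times the
  identity, so the supremum may be taken over a compact set on which the noise covariance is
  uniformly definite.
\<close>

section \<open>Positive semidefinite matrices\<close>

text \<open>Three obstacles shape the proof. First, covariances may be singular, so neither the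
  optimal dual matrix \<open>T\<close> nor an aligning rotation can be written down directly; both
  come from definite perturbations, where inverses and polar decompositions exist, followed by a
  limit. The resulting dual statement \<open>fidelity_dual_bound\<close> is phrased for an arbitrary
  real \<open>c\<close> so that it serves twice: for an arbitrary coupling and for an arbitrary
  factor \<open>X\<close>. Second, the noise covariance ranges over the open definite cone, so the
  feasible set need not be closed and the formula with the inverse may break down at its boundary.
  The passage to covariances above \<open>lambda_min\<close> therefore precedes compactness, and it
  also yields the Loewner bounds on the maximizer. Working with factors replaces Gelbrich balls by
  norm balls, so no continuity of the square root is required. Third, conditional expectations are
  avoided: all that is needed of normal laws is their second moments and invariance under orthogonal
  maps, which rests on that of Lebesgue measure.\<close>

declare transpose_matrix_vector [simp del]

section \<open>Matrix products, transposes and traces as continuous maps\<close>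

lemma matrix_mult_bounded_bilinear:
  "bounded_bilinear ((**) :: real^'n^'m \<Rightarrow> real^'k^'n \<Rightarrow> real^'k^'m)"
  by (auto simp: bilinear_conv_bounded_bilinear [symmetric] bilinear_def linear_iff
      matrix_matrix_mult_def vec_eq_iff sum.distrib algebra_simps sum_distrib_left)

lemma transpose_bounded_linear: "bounded_linear (transpose :: real^'n^'m \<Rightarrow> real^'m^'n)"
  by (auto simp: linear_conv_bounded_linear [symmetric] linear_iff transpose_def vec_eq_iff)

lemma trace_bounded_linear: "bounded_linear (trace :: real^'n^'n \<Rightarrow> real)"
  by (auto simp: linear_conv_bounded_linear [symmetric] linear_iff trace_def sum.distrib sum_distrib_left)

lemmas tendsto_matrix_mult = bounded_bilinear.tendsto [OF matrix_mult_bounded_bilinear]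
lemmas tendsto_transpose = bounded_linear.tendsto [OF transpose_bounded_linear]
lemmas tendsto_trace = bounded_linear.tendsto [OF trace_bounded_linear]
lemmas continuous_on_matrix_mult [continuous_intros] =
  bounded_bilinear.continuous_on [OF matrix_mult_bounded_bilinear]
lemmas continuous_on_transpose [continuous_intros] =
  bounded_linear.continuous_on [OF transpose_bounded_linear]
lemmas continuous_on_trace [continuous_intros] =
  bounded_linear.continuous_on [OF trace_bounded_linear]

lemma tendsto_matrix_vector_mult:
  fixes A :: "'a \<Rightarrow> real^'n^'m"
  assumes "(A \<longlongrightarrow> B) F"
  shows "((\<lambda>x. A x *v v) \<longlongrightarrow> B *v v) F"
  using assms by (intro vec_tendstoI) (auto simp: matrix_vector_mult_def intro!: tendsto_intros)

lemmas matrix_mult_bilinear_simps =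
  bounded_bilinear.add_left [OF matrix_mult_bounded_bilinear]
  bounded_bilinear.add_right [OF matrix_mult_bounded_bilinear]
  bounded_bilinear.diff_left [OF matrix_mult_bounded_bilinear]
  bounded_bilinear.diff_right [OF matrix_mult_bounded_bilinear]
  bounded_bilinear.scaleR_left [OF matrix_mult_bounded_bilinear]
  bounded_bilinear.scaleR_right [OF matrix_mult_bounded_bilinear]
  bounded_bilinear.minus_left [OF matrix_mult_bounded_bilinear]
  bounded_bilinear.minus_right [OF matrix_mult_bounded_bilinear]
  bounded_bilinear.zero_left [OF matrix_mult_bounded_bilinear]
  bounded_bilinear.zero_right [OF matrix_mult_bounded_bilinear]

lemmas transpose_linear_simps =
  linear_add [OF bounded_linear.linear [OF transpose_bounded_linear]]
  linear_diff [OF bounded_linear.linear [OF transpose_bounded_linear]]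
  linear_scale [OF bounded_linear.linear [OF transpose_bounded_linear]]

lemma trace_scaleR: "trace (c *\<^sub>R A) = c * trace (A :: real^'n^'n)"
  by (simp add: trace_def sum_distrib_left)

lemma inner_transpose: "x \<bullet> (A *v y) = (transpose A *v x) \<bullet> y" for A :: "real^'n^'m"
  by (simp add: transpose_matrix_vector dot_lmul_matrix)

lemma inner_eq_trace: "X \<bullet> Y = trace (transpose X ** Y)" for X :: "real^'n^'m"
proof -
  have "trace (transpose X ** Y) = (\<Sum>i\<in>UNIV. \<Sum>k\<in>UNIV. X $ k $ i * Y $ k $ i)"
    by (simp add: trace_def matrix_matrix_mult_def transpose_def)
  also have "\<dots> = X \<bullet> Y"
    by (subst sum.swap) (simp add: inner_vec_def)
  finally show ?thesis ..
qed

lemma norm_eq_trace: "(norm X)\<^sup>2 = trace (X ** transpose X)" for X :: "real^'n^'m"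
  unfolding power2_norm_eq_inner inner_eq_trace by (rule trace_mul_sym)

lemma trace_eq_sum_inner_axis: "trace A = (\<Sum>i\<in>UNIV. axis i 1 \<bullet> (A *v axis i 1))" for A :: "real^'n^'n"
  by (simp add: trace_def matrix_vector_mult_basis inner_axis' column_def)

section \<open>Eigenvectors of symmetric matrices\<close>

lemma quadratic_nonneg_imp_linear_coeff_0:
  fixes a b :: real
  assumes "\<And>t. 0 \<le> 2 * t * a + t\<^sup>2 * b"
  shows "a = 0"
proof (rule ccontr)
  assume "a \<noteq> 0"
  \<comment> \<open>Any positive \<open>c\<close> above \<open>b\<close> would do: at
    \<open>t = - a / c\<close> the linear term outweighs the quadratic one.\<close>
  define c where "c = \<bar>b\<bar> + 1"
  have c: "c > 0" "b < c" by (auto simp: c_def)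
  have "0 \<le> 2 * (- a / c) * a + (- a / c)\<^sup>2 * b" by (rule assms)
  also have "\<dots> = a\<^sup>2 / c\<^sup>2 * (b - 2 * c)"
    using c by (simp add: field_simps power2_eq_square)
  also have "\<dots> < 0"
    using c \<open>a \<noteq> 0\<close> by (intro mult_pos_neg) auto
  finally show False by simp
qed

text \<open>Compactness gives a minimiser \<open>v\<close> of the quadratic form on the unit sphere
  of \<open>V\<close>. Its first variation in every direction of \<open>V\<close> vanishes, so the
  residual \<open>A v - l v\<close> is orthogonal to \<open>V\<close>; invariance puts it into
  \<open>V\<close>, hence it is zero. The version relative to a subspace is what the construction of
  an eigenbasis needs.\<close>

lemma symmetric_eigenvector_in_subspace:
  fixes A :: "real^'n^'n"
  assumes sym: "transpose A = A" and V: "subspace V" and inv: "\<And>u. u \<in> V \<Longrightarrow> A *v u \<in> V"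
    and ne: "u0 \<in> V" "u0 \<noteq> 0"
  obtains v l where "v \<in> V" "norm v = 1" "A *v v = l *\<^sub>R v"
    "\<And>u. u \<in> V \<Longrightarrow> l * (norm u)\<^sup>2 \<le> u \<bullet> (A *v u)"
proof -
  let ?C = "V \<inter> sphere 0 1"
  have "compact ?C"
    using V by (simp add: closed_subspace closed_Int_compact)
  moreover have "(1 / norm u0) *\<^sub>R u0 \<in> ?C"
    using ne V by (auto simp: subspace_scale)
  moreover have "continuous_on ?C (\<lambda>u. u \<bullet> (A *v u))"
    by (intro continuous_intros linear_continuous_on matrix_vector_mul_bounded_linear)
  ultimately obtain v where v: "v \<in> ?C" "\<And>u. u \<in> ?C \<Longrightarrow> v \<bullet> (A *v v) \<le> u \<bullet> (A *v u)"
    using continuous_attains_inf [of ?C "\<lambda>u. u \<bullet> (A *v u)"] by blast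
  define l where "l = v \<bullet> (A *v v)"
  have nv: "norm v = 1" "v \<in> V" using v by auto
  have vv: "v \<bullet> v = 1" using nv by (simp add: norm_eq_1)
  have ge: "l * (norm u)\<^sup>2 \<le> u \<bullet> (A *v u)" if "u \<in> V" for u
  proof (cases "u = 0")
    case False
    let ?w = "(1 / norm u) *\<^sub>R u"
    have "?w \<in> ?C" using that False V by (auto simp: subspace_scale)
    then have "l \<le> ?w \<bullet> (A *v ?w)" unfolding l_def by (rule v(2))
    also have "\<dots> = (u \<bullet> (A *v u)) / (norm u)\<^sup>2"
      by (simp add: matrix_vector_mult_scaleR power2_eq_square)
    finally show ?thesis using False by (simp add: field_simps)
  qed simp
  have "w \<bullet> (A *v v - l *\<^sub>R v) = 0" if w: "w \<in> V" for w
  proof (rule quadratic_nonneg_imp_linear_coeff_0)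
    fix t :: real
    have "v + t *\<^sub>R w \<in> V" using w nv V by (simp add: subspace_add subspace_scale)
    from ge [OF this]
    have "0 \<le> (v + t *\<^sub>R w) \<bullet> (A *v (v + t *\<^sub>R w)) - l * ((v + t *\<^sub>R w) \<bullet> (v + t *\<^sub>R w))"
      by (simp add: power2_norm_eq_inner)
    moreover have "v \<bullet> (A *v w) = w \<bullet> (A *v v)"
      using inner_transpose [of v A w] sym by (simp add: inner_commute)
    ultimately show "0 \<le> 2 * t * (w \<bullet> (A *v v - l *\<^sub>R v)) + t\<^sup>2 * (w \<bullet> (A *v w) - l * (w \<bullet> w))"
      by (simp add: matrix_vector_right_distrib matrix_vector_mult_scaleR l_def [symmetric] vv
          algebra_simps power2_eq_square inner_commute)
  qed
  from this [of "A *v v - l *\<^sub>R v"] have "A *v v = l *\<^sub>R v"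
    using nv inv V by (simp add: subspace_diff subspace_scale)
  with that nv ge show thesis by blast
qed

lemma symmetric_min_eigenvector:
  fixes A :: "real^'n^'n"
  assumes sym: "transpose A = A"
  obtains v l where "norm v = 1" "A *v v = l *\<^sub>R v" "\<And>u. l * (norm u)\<^sup>2 \<le> u \<bullet> (A *v u)"
proof (rule symmetric_eigenvector_in_subspace [OF sym subspace_UNIV])
  show "axis undefined 1 \<noteq> (0 :: real^'n)" by (simp add: axis_eq_0_iff)
qed (use that in auto)

text \<open>An orthonormal set of eigenvectors of greatest cardinality spans: otherwise its
  orthogonal complement, invariant by symmetry, would contain one more. The dimension bounds the
  cardinality, which replaces an induction on the dimension.\<close>

lemma symmetric_orthonormal_eigenbasis:
  fixes A :: "real^'n^'n"
  assumes sym: "transpose A = A"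
  obtains B l where "finite B" "pairwise orthogonal B" "\<And>b. b \<in> B \<Longrightarrow> norm b = 1" "span B = UNIV"
    "\<And>b. b \<in> B \<Longrightarrow> A *v b = l b *\<^sub>R b"
proof -
  define P where "P B \<longleftrightarrow> pairwise orthogonal B \<and> (\<forall>b\<in>B. norm b = 1) \<and> (\<forall>b\<in>B. \<exists>l. A *v b = l *\<^sub>R b)"
    for B
  have fin: "finite B \<and> card B \<le> DIM(real^'n)" if "P B" for B
  proof -
    have "independent B"
      using that by (intro pairwise_orthogonal_independent) (auto simp: P_def)
    then show ?thesis by (metis independent_bound)
  qed
  have "P {}" by (simp add: P_def)
  moreover have "\<forall>B. P B \<longrightarrow> card B < Suc (DIM(real^'n))" using fin by (simp add: less_Suc_eq_le)
  ultimately have "\<exists>B. P B \<and> (\<forall>C. P C \<longrightarrow> card C \<le> card B)"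
    by (rule ex_has_greatest_nat [where f = card])
  then obtain B where B: "P B" "\<And>C. P C \<Longrightarrow> card C \<le> card B" by blast
  have "span B = UNIV"
  proof (rule ccontr)
    assume "span B \<noteq> UNIV"
    then obtain x where x: "x \<noteq> 0" "\<And>y. y \<in> span B \<Longrightarrow> orthogonal x y"
      using orthogonal_to_subspace_exists_gen [of B UNIV] by auto
    define V where "V = {y. \<forall>x \<in> B. orthogonal x y}"
    have V: "subspace V" unfolding V_def by (rule subspace_orthogonal_to_vectors)
    have inv: "A *v u \<in> V" if "u \<in> V" for u
    proof -
      have "b \<bullet> (A *v u) = 0" if "b \<in> B" for b
      proof -
        obtain l where "A *v b = l *\<^sub>R b" using B(1) \<open>b \<in> B\<close> unfolding P_def by blast
        then show ?thesis
          using \<open>u \<in> V\<close> \<open>b \<in> B\<close> by (simp add: inner_transpose sym orthogonal_def V_def)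
      qed
      then show ?thesis by (simp add: orthogonal_def V_def)
    qed
    have "x \<in> V" using x by (auto simp: span_base orthogonal_commute V_def)
    then obtain v l where "v \<in> V" and v: "norm v = 1" "A *v v = l *\<^sub>R v"
      using symmetric_eigenvector_in_subspace [OF sym V inv _ x(1)] by blast
    then have vB: "orthogonal b v" if "b \<in> B" for b using that by (simp add: V_def)
    have "v \<notin> B" using vB [of v] v by (auto simp: orthogonal_def)
    moreover have "P (insert v B)"
      using B(1) v vB unfolding P_def by (auto simp: pairwise_insert orthogonal_commute)
    ultimately show False using B(2) [of "insert v B"] fin [OF B(1)] by simp
  qed
  moreover obtain l where "\<And>b. b \<in> B \<Longrightarrow> A *v b = l b *\<^sub>R b"
    using B(1) unfolding P_def by metis
  ultimately show thesis using that B(1) fin [OF B(1)] unfolding P_def by blast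
qed

text \<open>The least eigenvalue bounds the quadratic form from below, so only eigenvectors have to
  be tested. The order arguments below thus reduce to a computation on a single vector.\<close>

lemma psd_mat_eigenvaluesI:
  fixes A :: "real^'n^'n"
  assumes "transpose A = A" and "\<And>v l. norm v = 1 \<Longrightarrow> A *v v = l *\<^sub>R v \<Longrightarrow> 0 \<le> l"
  shows "psd_mat A"
proof -
  obtain v l where v: "norm v = 1" "A *v v = l *\<^sub>R v" "\<And>u. l * (norm u)\<^sup>2 \<le> u \<bullet> (A *v u)"
    using symmetric_min_eigenvector [OF assms(1)] by blast
  then have "0 \<le> l" using assms by blast
  then have "0 \<le> l * (norm u)\<^sup>2" for u by simp
  then have "0 \<le> u \<bullet> (A *v u)" for u
    using v(3) order_trans by blast
  then show ?thesis using assms by (simp add: psd_mat_def)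
qed

section \<open>The cone of semidefinite matrices\<close>

lemma psd_mat_add: "psd_mat A \<Longrightarrow> psd_mat B \<Longrightarrow> psd_mat (A + B)"
  by (auto simp: psd_mat_def transpose_linear_simps matrix_vector_mult_add_rdistrib inner_add_right)

lemma psd_mat_scaleR: "psd_mat A \<Longrightarrow> 0 \<le> c \<Longrightarrow> psd_mat (c *\<^sub>R A)"
  by (auto simp: psd_mat_def transpose_linear_simps simp flip: scaleR_matrix_vector_assoc)

lemma psd_mat_1: "psd_mat (mat 1)"
  by (auto simp: psd_mat_def)

lemma psd_mat_0: "psd_mat 0"
  by (auto simp: psd_mat_def transpose_def vec_eq_iff)

lemma psd_mat_symmetric: "psd_mat A \<Longrightarrow> transpose A = A"
  by (simp add: psd_mat_def)

lemma psd_mat_conj: "psd_mat A \<Longrightarrow> psd_mat (M ** A ** transpose M)"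
  for M :: "real^'n^'m"
  unfolding psd_mat_def
  by (simp add: matrix_transpose_mul matrix_mul_assoc)
    (simp add: inner_transpose [of _ M] flip: matrix_vector_mul_assoc)

lemma psd_mat_mult_transpose: "psd_mat (M ** transpose M)" for M :: "real^'n^'m"
  using psd_mat_conj [OF psd_mat_1, of M] by simp

lemma pd_imp_psd_mat: "pd_mat A \<Longrightarrow> psd_mat A"
  unfolding pd_mat_def psd_mat_def by (metis inner_zero_left less_imp_le order_refl)

lemma psd_mat_trace_nonneg: "psd_mat A \<Longrightarrow> 0 \<le> trace A"
  by (auto simp: trace_eq_sum_inner_axis psd_mat_def intro!: sum_nonneg)

lemma closed_psd_mat: "closed {A :: real^'n^'n. psd_mat A}"
proof -
  have "{A :: real^'n^'n. psd_mat A} = {A. transpose A = A} \<inter> (\<Inter>v. {A. 0 \<le> v \<bullet> (A *v v)})"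
    by (auto simp: psd_mat_def)
  moreover have "closed {A :: real^'n^'n. transpose A = A}"
    by (intro closed_Collect_eq continuous_intros)
  moreover have "closed {A :: real^'n^'n. 0 \<le> v \<bullet> (A *v v)}" for v
  proof -
    have "continuous_on UNIV (\<lambda>A :: real^'n^'n. A *v v)"
      unfolding continuous_on_def by (intro ballI tendsto_matrix_vector_mult tendsto_ident_at)
    then show ?thesis by (intro closed_Collect_le continuous_intros) auto
  qed
  ultimately show ?thesis by (simp add: closed_Int closed_INT)
qed

lemma psd_mat_tendsto:
  assumes "X \<longlonglongrightarrow> A" "\<And>n::nat. psd_mat (X n)"
  shows "psd_mat A"
  using closed_sequentially [OF closed_psd_mat, of X] assms by auto

section \<open>Operator monotonicity and square roots\<close>

lemma psd_square_le_imp_le: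
  fixes A B :: "real^'n^'n"
  assumes A: "psd_mat A" and B: "psd_mat B" and le: "psd_mat (A ** A - B ** B)"
  shows "psd_mat (A - B)"
proof (rule psd_mat_eigenvaluesI)
  show sym: "transpose (A - B) = A - B"
    using A B by (simp add: psd_mat_def transpose_linear_simps)
  fix v :: "real^'n" and l assume v: "norm v = 1" "(A - B) *v v = l *\<^sub>R v"
  show "0 \<le> l"
  proof (rule ccontr)
    assume l: "\<not> 0 \<le> l"
    have Av: "A *v v = B *v v + l *\<^sub>R v"
      using v(2) by (simp add: matrix_vector_mult_diff_rdistrib algebra_simps)
    have vv: "v \<bullet> v = 1" using v by (simp add: norm_eq_1)
    have a: "0 \<le> v \<bullet> (A *v v)" "0 \<le> v \<bullet> (B *v v)" using A B by (auto simp: psd_mat_def)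
    have "0 \<le> v \<bullet> ((A ** A - B ** B) *v v)" using le by (simp add: psd_mat_def)
    also have "\<dots> = (A *v v) \<bullet> (A *v v) - (B *v v) \<bullet> (B *v v)"
      using inner_transpose [of v A "A *v v"] inner_transpose [of v B "B *v v"] A B
      by (simp add: psd_mat_def matrix_vector_mult_diff_rdistrib inner_diff_right matrix_vector_mul_assoc)
    \<comment> \<open>On an eigenvector of \<open>A - B\<close> the difference of squares factors. A
      negative \<open>l\<close> would force both nonnegative forms to vanish, yet their difference
      is \<open>l\<close>.\<close>
    also have "\<dots> = l * (v \<bullet> (A *v v) + v \<bullet> (B *v v))"
      by (simp add: Av algebra_simps vv inner_commute)
    finally have "v \<bullet> (A *v v) + v \<bullet> (B *v v) \<le> 0"
      using l by (simp add: zero_le_mult_iff)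
    with a have "v \<bullet> (A *v v) = 0" "v \<bullet> (B *v v) = 0" by auto
    then show False using l by (simp add: Av algebra_simps vv)
  qed
qed

lemma psd_mat_antisym:
  fixes A :: "real^'n^'n"
  assumes "psd_mat A" "psd_mat (- A)"
  shows "A = 0"
proof -
  have "A *v v = 0" for v
  proof -
    obtain B l where B: "finite B" "span B = UNIV" "\<And>b. b \<in> B \<Longrightarrow> A *v b = l b *\<^sub>R b"
      using symmetric_orthonormal_eigenbasis [OF psd_mat_symmetric [OF assms(1)]] by metis
    have "A *v b = 0" if "b \<in> B" for b
    proof -
      have "b \<bullet> (A *v b) = 0"
      proof (rule antisym)
        show "b \<bullet> (A *v b) \<le> 0"
          using assms(2) by (simp add: psd_mat_def matrix_vector_mult_def inner_vec_def sum_negf)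
        show "0 \<le> b \<bullet> (A *v b)"
          using assms(1) by (simp add: psd_mat_def)
      qed
      then show ?thesis using B(3) [OF that] by auto
    qed
    moreover have "v \<in> span B" using B by simp
    ultimately show ?thesis
      using linear_eq_0_on_span [OF matrix_vector_mul_linear, of B A v] by simp
  qed
  then show ?thesis by (metis matrix_eq matrix_vector_mult_0)
qed

lemma psd_sqrt_unique:
  assumes "psd_mat A" "psd_mat B" "A ** A = B ** B"
  shows "A = B"
proof -
  have "psd_mat (A - B)" "psd_mat (- (A - B))"
    using psd_square_le_imp_le [of A B] psd_square_le_imp_le [of B A] assms psd_mat_0 by auto
  then show ?thesis using psd_mat_antisym by fastforce
qed

lemma psd_sqrt_exists:
  fixes A :: "real^'n^'n"
  assumes A: "psd_mat A"
  shows "\<exists>R. psd_mat R \<and> R ** R = A"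
proof -
  obtain B l where B: "finite B" "pairwise orthogonal B" "\<And>b. b \<in> B \<Longrightarrow> norm b = 1" "span B = UNIV"
    "\<And>b. b \<in> B \<Longrightarrow> A *v b = l b *\<^sub>R b"
    using symmetric_orthonormal_eigenbasis [OF psd_mat_symmetric [OF A]] by metis
  have l: "0 \<le> l b" if "b \<in> B" for b
  proof -
    have "0 \<le> b \<bullet> (A *v b)" using A by (simp add: psd_mat_def)
    then show ?thesis using B(3,5) [OF that] by (simp add: norm_eq_1)
  qed
  define f where "f x = (\<Sum>b\<in>B. (sqrt (l b) * (b \<bullet> x)) *\<^sub>R b)" for x
  have "linear f"
    by (auto simp: linear_iff f_def algebra_simps sum.distrib scaleR_right.sum)
  then have f: "matrix f *v x = f x" for x by (simp add: matrix_works)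
  have sym: "y \<bullet> f x = f y \<bullet> x" for x y
    by (simp add: f_def inner_sum_right inner_sum_left algebra_simps inner_commute)
  have "psd_mat (matrix f)"
    unfolding psd_mat_def
  proof (intro conjI allI)
    show "transpose (matrix f) = matrix f"
    proof -
      have "(transpose (matrix f) *v x) = matrix f *v x" for x
        by (rule vector_eq_rdot [THEN iffD1]) (simp add: f sym flip: inner_transpose)
      then show ?thesis by (simp add: matrix_eq)
    qed
    show "0 \<le> x \<bullet> (matrix f *v x)" for x
      unfolding f f_def inner_sum_right
      by (intro sum_nonneg) (auto simp: l inner_commute mult.assoc)
  qed
  moreover have "matrix f ** matrix f = A"
  proof -
    have "f (f x) = A *v x" for x
    proof -
      have lin: "linear (f \<circ> f)" using \<open>linear f\<close> by (intro linear_compose)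
      have "(f \<circ> f) x = A *v x"
      proof (rule linear_eq_on [OF lin matrix_vector_mul_linear, of x B A])
        show "x \<in> span B" using B by simp
        fix b assume b: "b \<in> B"
        \<comment> \<open>Stated for all multiples of \<open>b\<close>, because it is applied first
          to \<open>b\<close> and then to \<open>f b\<close>.\<close>
        have "f y = sqrt (l b) *\<^sub>R y" if "y = c *\<^sub>R b" for y c
        proof -
          have "f b = (\<Sum>a\<in>B. if a = b then sqrt (l b) *\<^sub>R b else 0)"
            unfolding f_def
          proof (rule sum.cong)
            fix a assume a: "a \<in> B"
            then have "a \<noteq> b \<Longrightarrow> a \<bullet> b = 0" using B(2) b by (auto simp: pairwise_def orthogonal_def)
            moreover have "b \<bullet> b = 1" using B(3) [OF b] by (simp add: norm_eq_1)
            ultimately show "(sqrt (l a) * (a \<bullet> b)) *\<^sub>R a = (if a = b then sqrt (l b) *\<^sub>R b else 0)"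
              by auto
          qed simp
          then have "f b = sqrt (l b) *\<^sub>R b" using b B(1) by simp
          then show ?thesis using that \<open>linear f\<close> by (simp add: linear_scale)
        qed
        from this [of b 1] this [of "sqrt (l b) *\<^sub>R b" "sqrt (l b)"]
        show "(f \<circ> f) b = A *v b"
          using l [OF b] B(5) [OF b] by simp
      qed
      then show ?thesis by simp
    qed
    then show ?thesis by (simp add: matrix_eq f flip: matrix_vector_mul_assoc)
  qed
  ultimately show ?thesis by blast
qed

lemma msqrt_eqI:
  assumes "psd_mat R" "R ** R = A"
  shows "msqrt A = R"
  unfolding msqrt_def
proof (rule the_equality)
  show "psd_mat R \<and> R ** R = A" using assms by simp
  show "S = R" if "psd_mat S \<and> S ** S = A" for S
    by (rule psd_sqrt_unique) (use that assms in simp_all)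
qed

lemma msqrt:
  assumes "psd_mat A"
  shows msqrt_psd: "psd_mat (msqrt A)" and msqrt_square: "msqrt A ** msqrt A = A"
    and msqrt_transpose: "transpose (msqrt A) = msqrt A"
proof -
  have "psd_mat (msqrt A) \<and> msqrt A ** msqrt A = A"
    using psd_sqrt_exists [OF assms] msqrt_eqI [of _ A] by metis
  then show "psd_mat (msqrt A)" "msqrt A ** msqrt A = A" "transpose (msqrt A) = msqrt A"
    by (auto simp: psd_mat_def)
qed

text \<open>The product need not be symmetric; cyclicity of the trace replaces it by the congruence
  of \<open>B\<close> with \<open>msqrt A\<close>, which is semidefinite.\<close>

lemma trace_psd_mult_nonneg:
  assumes A: "psd_mat A" and B: "psd_mat B"
  shows "0 \<le> trace (A ** B)"
proof -
  have "trace (A ** B) = trace (msqrt A ** (msqrt A ** B))"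
    using msqrt_square [OF A] by (simp add: matrix_mul_assoc)
  also have "\<dots> = trace (msqrt A ** B ** msqrt A)" by (rule trace_mul_sym)
  also have "\<dots> \<ge> 0"
    using psd_mat_trace_nonneg [OF psd_mat_conj [OF B, of "msqrt A"]] msqrt_transpose [OF A] by simp
  finally show ?thesis by simp
qed

section \<open>Inverses, the Loewner order and the smallest eigenvalue\<close>

lemma invertible_matrix_inv:
  assumes "invertible (A :: real^'n^'n)"
  shows "A ** matrix_inv A = mat 1" "matrix_inv A ** A = mat 1"
proof -
  have "A ** matrix_inv A = mat 1 \<and> matrix_inv A ** A = mat 1"
    unfolding matrix_inv_def using assms unfolding invertible_def by (rule someI_ex)
  then show "A ** matrix_inv A = mat 1" "matrix_inv A ** A = mat 1" by auto
qed

lemma pd_mat_invertible: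
  assumes "pd_mat A"
  shows "invertible A"
proof -
  have "\<forall>x. A *v x = 0 \<longrightarrow> x = 0" using assms by (force simp: pd_mat_def)
  then show ?thesis unfolding invertible_left_inverse matrix_left_invertible_ker .
qed

lemmas pd_mat_inv = invertible_matrix_inv [OF pd_mat_invertible]

lemma pd_mat_inv_transpose:
  assumes "pd_mat A"
  shows "transpose (matrix_inv A) = matrix_inv A"
proof -
  have "transpose (matrix_inv A) ** A = mat 1"
    using arg_cong [OF pd_mat_inv(1) [OF assms], of transpose] assms
    by (simp add: matrix_transpose_mul pd_mat_def)
  then have "transpose (matrix_inv A) ** (A ** matrix_inv A) = matrix_inv A"
    by (simp add: matrix_mul_assoc)
  then show ?thesis by (simp add: pd_mat_inv(1) [OF assms])
qed

lemma pd_mat_inv_psd: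
  assumes "pd_mat A"
  shows "psd_mat (matrix_inv A)"
proof -
  have "psd_mat (matrix_inv A ** A ** transpose (matrix_inv A))"
    by (intro psd_mat_conj pd_imp_psd_mat assms)
  then show ?thesis by (simp add: pd_mat_inv assms pd_mat_inv_transpose)
qed

lemma pd_mat_add:
  assumes "psd_mat A" "pd_mat B"
  shows "pd_mat (A + B)"
  using assms by (auto simp: pd_mat_def psd_mat_def transpose_linear_simps
      matrix_vector_mult_add_rdistrib inner_add_right intro: add_nonneg_pos)

lemma pd_mat_scaled_identity: "0 < c \<Longrightarrow> pd_mat (c *\<^sub>R mat 1)"
  by (auto simp: pd_mat_def transpose_linear_simps simp flip: scaleR_matrix_vector_assoc)

lemma loewner_ge_identity_iff:
  "transpose A = A \<Longrightarrow> loewner_ge A (c *\<^sub>R mat 1) \<longleftrightarrow> (\<forall>v. c * (norm v)\<^sup>2 \<le> v \<bullet> (A *v v))"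
  by (auto simp: loewner_ge_def psd_mat_def transpose_linear_simps matrix_vector_mult_diff_rdistrib
      inner_diff_right power2_norm_eq_inner simp flip: scaleR_matrix_vector_assoc)

lemma loewner_ge_trans: "loewner_ge A B \<Longrightarrow> loewner_ge B C \<Longrightarrow> loewner_ge A C"
  unfolding loewner_ge_def using psd_mat_add [of "A - B" "B - C"] by simp

lemma lambda_min:
  assumes A: "psd_mat (A :: real^'n^'n)"
  shows loewner_ge_lambda_min: "loewner_ge A (lambda_min A *\<^sub>R mat 1)"
    and lambda_min_nonneg: "0 \<le> lambda_min A"
    and lambda_min_pos: "pd_mat A \<Longrightarrow> 0 < lambda_min A"
proof -
  let ?E = "{l. \<exists>v. v \<noteq> 0 \<and> A *v v = l *\<^sub>R v}"
  have sym: "transpose A = A" using A by (rule psd_mat_symmetric)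
  obtain v l where v: "norm v = 1" "A *v v = l *\<^sub>R v" "\<And>u. l * (norm u)\<^sup>2 \<le> u \<bullet> (A *v u)"
    using symmetric_min_eigenvector [OF sym] by blast
  have "v \<noteq> 0" using v(1) by auto
  then have lE: "l \<in> ?E" using v(2) by blast
  \<comment> \<open>\<open>Min\<close> is informative only on a finite set. Eigenvectors for
    distinct eigenvalues are orthogonal, so choosing one per eigenvalue is injective with a pairwise
    orthogonal, hence finite, image.\<close>
  have "finite ?E"
  proof -
    define ev where "ev l = (SOME v. v \<noteq> 0 \<and> A *v v = l *\<^sub>R v)" for l
    have ev: "ev l \<noteq> 0 \<and> A *v ev l = l *\<^sub>R ev l" if "l \<in> ?E" for l
      unfolding ev_def by (rule someI_ex) (use that in simp)
    have orth: "ev k \<bullet> ev l = 0" if "k \<in> ?E" "l \<in> ?E" "k \<noteq> l" for k l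
    proof -
      have "ev k \<bullet> (A *v ev l) = (A *v ev k) \<bullet> ev l"
        using inner_transpose [of "ev k" A "ev l"] sym by simp
      then show ?thesis using ev that by simp
    qed
    have "inj_on ev ?E"
    proof (rule inj_onI, rule ccontr)
      fix k l assume kl: "k \<in> ?E" "l \<in> ?E" "ev k = ev l" "k \<noteq> l"
      from orth [OF kl(1,2,4)] have "ev k = 0" using kl(3) by simp
      with ev [OF kl(1)] show False by simp
    qed
    moreover have "finite (ev ` ?E)"
      by (rule pairwise_orthogonal_imp_finite) (use orth in \<open>auto simp: pairwise_def orthogonal_def\<close>)
    ultimately show ?thesis by (rule finite_imageD [rotated])
  qed
  moreover have "l \<le> k" if "k \<in> ?E" for k
  proof -
    from that have "\<exists>u. u \<noteq> 0 \<and> A *v u = k *\<^sub>R u" unfolding mem_Collect_eq .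
    then obtain u where u: "u \<noteq> 0" "A *v u = k *\<^sub>R u" by metis
    have "l * (norm u)\<^sup>2 \<le> k * (norm u)\<^sup>2"
      using v(3) [of u] u(2) by (simp add: power2_norm_eq_inner)
    then show ?thesis using u(1) by simp
  qed
  ultimately have "lambda_min A = l"
    unfolding lambda_min_def using lE by (intro Min_eqI) auto
  note l = this
  have vv: "v \<bullet> (A *v v) = l" "v \<noteq> 0" using v by (auto simp: norm_eq_1)
  show "loewner_ge A (lambda_min A *\<^sub>R mat 1)"
    unfolding loewner_ge_identity_iff [OF sym] l using v(3) by blast
  show "0 \<le> lambda_min A"
    using A vv l unfolding psd_mat_def by metis
  show "0 < lambda_min A" if "pd_mat A"
    using that vv l unfolding pd_mat_def by metis
qed

section \<open>The Gelbrich distance\<close>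

lemma trace_mat_1: "trace (mat 1 :: real^'n^'n) = real CARD('n)"
  by (simp add: trace_def mat_def)

lemma compact_orthogonal_matrix: "compact {K :: real^'n^'n. orthogonal_matrix K}"
proof -
  have "norm K \<le> sqrt (real CARD('n))" if "orthogonal_matrix K" for K :: "real^'n^'n"
    using that norm_eq_trace [of K] by (intro real_le_rsqrt) (simp add: orthogonal_matrix_def trace_mat_1)
  then have "bounded {K :: real^'n^'n. orthogonal_matrix K}"
    by (auto simp: bounded_iff)
  moreover have "closed {K :: real^'n^'n. orthogonal_matrix K}"
    unfolding orthogonal_matrix by (intro closed_Collect_eq continuous_intros)
  ultimately show ?thesis by (simp add: compact_eq_bounded_closed)
qed

lemma psd_mat_shifted_square:
  assumes "psd_mat R" "0 \<le> e"
  shows "psd_mat ((R + e *\<^sub>R mat 1) ** (R + e *\<^sub>R mat 1) - R ** R)"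
proof -
  have "(R + e *\<^sub>R mat 1) ** (R + e *\<^sub>R mat 1) - R ** R = e *\<^sub>R R + (e *\<^sub>R R + (e * e) *\<^sub>R mat 1)"
    by (simp add: matrix_mult_bilinear_simps scaleR_right_distrib)
  also have "psd_mat \<dots>"
    using assms by (intro psd_mat_add psd_mat_scaleR psd_mat_1) auto
  finally show ?thesis .
qed

text \<open>\<open>K\<close> inverts the orthogonal factor in the polar decomposition of
  \<open>R ** Q\<close>, whose positive factor is \<open>N\<close>. For the last clause,
  \<open>N ** N\<close> dominates \<open>lam\<close> times \<open>Q ** Q\<close>, hence
  \<open>N\<close> dominates \<open>sqrt lam\<close> times \<open>Q\<close> by operator
  monotonicity. Evaluating this at an eigenvector of \<open>Q\<close> and cancelling its positive
  eigenvalue leaves a bound that no longer contains the eigenvalue.\<close>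

lemma orthogonal_alignment_pd:
  fixes R Q :: "real^'n^'n"
  assumes R: "pd_mat R" and Q: "pd_mat Q" and lam: "0 \<le> lam"
    and ge: "loewner_ge (R ** R) (lam *\<^sub>R mat 1)"
  shows "\<exists>K. orthogonal_matrix K \<and> psd_mat (K ** R ** Q) \<and>
    (\<forall>v m. Q *v v = m *\<^sub>R v \<longrightarrow> sqrt lam * (norm v)\<^sup>2 \<le> v \<bullet> ((K ** R) *v v))"
proof -
  let ?A = "R ** Q"
  have A: "?A ** matrix_inv ?A = mat 1" "matrix_inv ?A ** ?A = mat 1"
    by (rule invertible_matrix_inv, rule invertible_mult; rule pd_mat_invertible; fact)+
  have tR: "transpose R = R" and tQ: "transpose Q = Q" using R Q by (auto simp: pd_mat_def)
  have "psd_mat (transpose ?A ** ?A)"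
    using psd_mat_mult_transpose [of "transpose ?A"] by simp
  note N = msqrt [OF this]
  define N where "N = msqrt (transpose ?A ** ?A)"
  note N = N [folded N_def]
  define K where "K = N ** matrix_inv ?A"
  have KA: "K ** R ** Q = N"
    unfolding K_def by (metis A(2) matrix_mul_assoc matrix_mul_rid)
  have "transpose K ** K = transpose (matrix_inv ?A) ** (N ** N) ** matrix_inv ?A"
    by (simp add: K_def matrix_transpose_mul N(3) matrix_mul_assoc)
  also have "\<dots> = transpose (matrix_inv ?A) ** transpose ?A ** (?A ** matrix_inv ?A)"
    by (simp add: N(2) matrix_mul_assoc)
  also have "\<dots> = transpose (?A ** matrix_inv ?A)"
    unfolding A(1) matrix_transpose_mul [symmetric] by simp
  finally have "transpose K ** K = mat 1" unfolding A(1) by simp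
  then have "orthogonal_matrix K" by (simp add: orthogonal_matrix)
  moreover have "psd_mat (K ** R ** Q)" using N by (simp add: KA)
  moreover have "sqrt lam * (norm v)\<^sup>2 \<le> v \<bullet> ((K ** R) *v v)" if v: "Q *v v = m *\<^sub>R v" for v m
  proof (cases "v = 0")
    case False
    have "0 < v \<bullet> (Q *v v)" using Q False by (auto simp: pd_mat_def)
    then have "0 < m * (v \<bullet> v)" using v by simp
    then have m: "0 < m" using False by (auto intro: zero_less_mult_pos2)
    have "psd_mat (N - sqrt lam *\<^sub>R Q)"
    proof (rule psd_square_le_imp_le)
      have "psd_mat (Q ** (R ** R - lam *\<^sub>R mat 1) ** transpose Q)"
        using ge unfolding loewner_ge_def by (rule psd_mat_conj)
      also have "Q ** (R ** R - lam *\<^sub>R mat 1) ** transpose Q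
          = N ** N - sqrt lam *\<^sub>R Q ** sqrt lam *\<^sub>R Q"
        using lam by (simp add: N(2) tQ tR matrix_transpose_mul matrix_mult_bilinear_simps matrix_mul_assoc)
      finally show "psd_mat (N ** N - sqrt lam *\<^sub>R Q ** sqrt lam *\<^sub>R Q)" .
    qed (use N Q lam in \<open>auto intro: psd_mat_scaleR pd_imp_psd_mat\<close>)
    then have "0 \<le> v \<bullet> (N *v v) - sqrt lam * (v \<bullet> (Q *v v))"
      by (auto simp: psd_mat_def matrix_vector_mult_diff_rdistrib inner_diff_right
          simp flip: scaleR_matrix_vector_assoc)
    also have "N *v v = m *\<^sub>R ((K ** R) *v v)"
      unfolding KA [symmetric] by (simp add: v matrix_vector_mult_scaleR flip: matrix_vector_mul_assoc)
    finally have "m * (sqrt lam * (norm v)\<^sup>2) \<le> m * (v \<bullet> ((K ** R) *v v))"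
      by (simp add: v power2_norm_eq_inner algebra_simps)
    then show ?thesis using m by simp
  qed simp
  ultimately show ?thesis by (intro exI [of _ K] conjI allI impI)
qed

text \<open>The bound on eigenvectors of \<open>Q\<close> also covers its kernel, where \<open>psd_mat (K ** R ** Q)\<close>
  alone does not constrain \<open>K\<close>; it survives the passage to the limit from the definite case.\<close>

lemma orthogonal_alignment:
  fixes R Q :: "real^'n^'n"
  assumes R: "psd_mat R" and Q: "psd_mat Q" and lam: "0 \<le> lam"
    and ge: "loewner_ge (R ** R) (lam *\<^sub>R mat 1)"
  obtains K where "orthogonal_matrix K" "psd_mat (K ** R ** Q)"
    "\<forall>v m. Q *v v = m *\<^sub>R v \<longrightarrow> sqrt lam * (norm v)\<^sup>2 \<le> v \<bullet> ((K ** R) *v v)"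
proof -
  define e where "e k = inverse (real (Suc k))" for k
  define Rk where "Rk k = R + e k *\<^sub>R mat 1" for k
  define Qk where "Qk k = Q + e k *\<^sub>R mat 1" for k
  have e: "0 < e k" for k by (simp add: e_def)
  have e0: "e \<longlonglongrightarrow> 0" unfolding e_def by (rule LIMSEQ_inverse_real_of_nat)
  have "((\<lambda>k. R + e k *\<^sub>R mat 1) \<longlonglongrightarrow> R + 0 *\<^sub>R mat 1)" "((\<lambda>k. Q + e k *\<^sub>R mat 1) \<longlonglongrightarrow> Q + 0 *\<^sub>R mat 1)"
    by (intro tendsto_intros e0)+
  then have lim: "Rk \<longlonglongrightarrow> R" "Qk \<longlonglongrightarrow> Q" by (simp_all add: Rk_def [abs_def] Qk_def [abs_def])
  have "\<exists>K. orthogonal_matrix K \<and> psd_mat (K ** Rk k ** Qk k) \<and>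
    (\<forall>v m. Qk k *v v = m *\<^sub>R v \<longrightarrow> sqrt lam * (norm v)\<^sup>2 \<le> v \<bullet> ((K ** Rk k) *v v))" for k
  proof (rule orthogonal_alignment_pd [OF _ _ lam])
    show "pd_mat (Rk k)" "pd_mat (Qk k)"
      unfolding Rk_def Qk_def by (intro pd_mat_add R Q pd_mat_scaled_identity e)+
    have "loewner_ge (Rk k ** Rk k) (R ** R)"
      unfolding loewner_ge_def Rk_def by (rule psd_mat_shifted_square [OF R less_imp_le [OF e]])
    then show "loewner_ge (Rk k ** Rk k) (lam *\<^sub>R mat 1)" using ge by (rule loewner_ge_trans)
  qed
  then have "\<forall>k. \<exists>K. orthogonal_matrix K \<and> psd_mat (K ** Rk k ** Qk k) \<and>
    (\<forall>v m. Qk k *v v = m *\<^sub>R v \<longrightarrow> sqrt lam * (norm v)\<^sup>2 \<le> v \<bullet> ((K ** Rk k) *v v))" ..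
  from choice [OF this] obtain Ks where "\<forall>k. orthogonal_matrix (Ks k) \<and> psd_mat (Ks k ** Rk k ** Qk k) \<and>
    (\<forall>v m. Qk k *v v = m *\<^sub>R v \<longrightarrow> sqrt lam * (norm v)\<^sup>2 \<le> v \<bullet> ((Ks k ** Rk k) *v v))" ..
  note Kall = this
  note Ks = Kall [THEN spec, THEN conjunct1] Kall [THEN spec, THEN conjunct2, THEN conjunct1]
    Kall [THEN spec, THEN conjunct2, THEN conjunct2, THEN spec, THEN spec, THEN mp]
  \<comment> \<open>The aligning matrices need not converge; compactness of the orthogonal group
    supplies a limit along a subsequence.\<close>
  obtain K r where K: "orthogonal_matrix K" and r: "strict_mono r" and Kr: "(Ks \<circ> r) \<longlonglongrightarrow> K"
    using compact_orthogonal_matrix [unfolded compact_def, rule_format, of Ks] Ks(1) by auto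
  have lim': "(\<lambda>k. Rk (r k)) \<longlonglongrightarrow> R" "(\<lambda>k. Qk (r k)) \<longlonglongrightarrow> Q"
    using LIMSEQ_subseq_LIMSEQ [OF lim(1) r] LIMSEQ_subseq_LIMSEQ [OF lim(2) r] by (simp_all add: o_def)
  have KR: "(\<lambda>k. Ks (r k) ** Rk (r k)) \<longlonglongrightarrow> K ** R"
    using Kr lim' by (intro tendsto_matrix_mult) (simp_all add: o_def)
  have "psd_mat (K ** R ** Q)"
    by (rule psd_mat_tendsto [OF tendsto_matrix_mult [OF KR lim'(2)]]) (rule Ks)
  moreover have "sqrt lam * (norm v)\<^sup>2 \<le> v \<bullet> ((K ** R) *v v)" if v: "Q *v v = m *\<^sub>R v" for v m
  proof (rule LIMSEQ_le_const)
    show "(\<lambda>k. v \<bullet> ((Ks (r k) ** Rk (r k)) *v v)) \<longlonglongrightarrow> v \<bullet> ((K ** R) *v v)"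
      by (intro tendsto_intros tendsto_matrix_vector_mult KR)
    \<comment> \<open>The shift changes the eigenvalue but not the eigenvector, so even a kernel
      vector of \<open>Q\<close> is an eigenvector of every definite \<open>Qk\<close>.\<close>
    have "Qk (r k) *v v = (m + e (r k)) *\<^sub>R v" for k
      by (simp add: Qk_def v matrix_vector_mult_add_rdistrib scaleR_left_distrib
          flip: scaleR_matrix_vector_assoc)
    from Ks(3) [OF this]
    show "\<exists>N. \<forall>n\<ge>N. sqrt lam * (norm v)\<^sup>2 \<le> v \<bullet> ((Ks (r n) ** Rk (r n)) *v v)" by auto
  qed
  ultimately show thesis by (intro that [OF K] allI impI)
qed

text \<open>The fidelity on the right is half the infimum of the dual values. With
  \<open>R = msqrt S0\<close> and \<open>M = msqrt (R ** S ** R)\<close> the optimal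
  \<open>T\<close> is formally \<open>M\<close> multiplied on both sides by the inverse of
  \<open>R\<close>. Since \<open>R\<close> and \<open>M\<close> may be singular, \<open>R\<close> is
  shifted by \<open>e k\<close> and \<open>M\<close> by \<open>d\<close>. The limit in
  \<open>k\<close> is taken with \<open>d\<close> fixed, so that \<open>matrix_inv D\<close> stays
  constant; only then does \<open>d\<close> shrink.\<close>

lemma fidelity_dual_bound:
  fixes S S0 :: "real^'n^'n"
  assumes S: "psd_mat S" and S0: "psd_mat S0"
    and dual: "\<And>T T'. psd_mat T \<Longrightarrow> psd_mat T' \<Longrightarrow> T' ** T = mat 1 \<Longrightarrow>
      2 * c \<le> trace (T ** S0) + trace (T' ** S)"
  shows "c \<le> trace (msqrt (msqrt S0 ** S ** msqrt S0))"
proof -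
  define R where "R = msqrt S0"
  have R: "psd_mat R" "R ** R = S0" "transpose R = R"
    using msqrt [OF S0] by (simp_all add: R_def)
  have "psd_mat (R ** S ** R)" using psd_mat_conj [OF S, of R] R by simp
  note M = msqrt [OF this]
  define M where "M = msqrt (R ** S ** R)"
  note M = M [folded M_def]
  define e where "e k = inverse (real (Suc k))" for k
  have e: "0 < e k" for k by (simp add: e_def)
  have e0: "e \<longlonglongrightarrow> 0" unfolding e_def by (rule LIMSEQ_inverse_real_of_nat)
  have bound: "2 * c \<le> 2 * trace M + d * real CARD('n)" if d: "0 < d" for d
  proof -
    define D where "D = M + d *\<^sub>R mat 1"
    have D: "pd_mat D" unfolding D_def by (intro pd_mat_add M pd_mat_scaled_identity d)
    define Re where "Re k = R + e k *\<^sub>R mat 1" for k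
    have "2 * c \<le> trace D + trace (matrix_inv D ** (Re k ** S ** Re k))" for k
    proof -
      have Rk: "pd_mat (Re k)" unfolding Re_def by (intro pd_mat_add R pd_mat_scaled_identity e)
      let ?I = "matrix_inv (Re k)" and ?J = "matrix_inv D"
      have I: "Re k ** ?I = mat 1" "?I ** Re k = mat 1" "transpose ?I = ?I" "transpose (Re k) = Re k"
        using pd_mat_inv [OF Rk] pd_mat_inv_transpose [OF Rk] Rk by (auto simp: pd_mat_def)
      have J: "?J ** D = mat 1" "psd_mat ?J" using pd_mat_inv [OF D] pd_mat_inv_psd [OF D] by auto
      let ?T = "?I ** D ** ?I" and ?T' = "Re k ** ?J ** Re k"
      have "psd_mat ?T" using psd_mat_conj [OF pd_imp_psd_mat [OF D], of ?I] I by simp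
      moreover have "psd_mat ?T'" using psd_mat_conj [OF J(2), of "Re k"] I by simp
      moreover have "?T' ** ?T = mat 1"
      proof -
        have "?T' ** ?T = Re k ** (?J ** (Re k ** ?I) ** D) ** ?I" by (simp add: matrix_mul_assoc)
        then show ?thesis by (simp add: I J)
      qed
      ultimately have "2 * c \<le> trace (?T ** S0) + trace (?T' ** S)" by (rule dual)
      \<comment> \<open>The square of \<open>Re k\<close> dominates \<open>S0\<close>, so
        conjugating \<open>S0\<close> with the inverse of \<open>Re k\<close> gives at most the
        identity.\<close>
      also have "trace (?T ** S0) \<le> trace D"
      proof -
        have "psd_mat (?I ** (Re k ** Re k - R ** R) ** transpose ?I)"
          unfolding Re_def
          by (intro psd_mat_conj psd_mat_shifted_square R(1) less_imp_le [OF e])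
        also have "?I ** (Re k ** Re k - R ** R) ** transpose ?I = mat 1 - ?I ** S0 ** ?I"
        proof -
          have "?I ** (Re k ** Re k) ** ?I = (?I ** Re k) ** (Re k ** ?I)"
            by (simp only: matrix_mul_assoc)
          then show ?thesis by (simp add: matrix_mult_bilinear_simps I R)
        qed
        finally have "0 \<le> trace (D ** (mat 1 - ?I ** S0 ** ?I))"
          by (intro trace_psd_mult_nonneg pd_imp_psd_mat [OF D])
        also have "\<dots> = trace D - trace (D ** ?I ** S0 ** ?I)"
          by (simp add: matrix_mult_bilinear_simps trace_sub matrix_mul_assoc)
        also have "trace (D ** ?I ** S0 ** ?I) = trace (?T ** S0)"
          by (subst trace_mul_sym) (simp add: matrix_mul_assoc)
        finally show ?thesis by simp
      qed
      also have "trace (?T' ** S) = trace (?J ** (Re k ** S ** Re k))"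
      proof -
        have "trace (Re k ** (?J ** Re k ** S)) = trace (?J ** Re k ** S ** Re k)" by (rule trace_mul_sym)
        then show ?thesis by (simp add: matrix_mul_assoc)
      qed
      finally show ?thesis by simp
    qed
    moreover have "(\<lambda>k. trace D + trace (matrix_inv D ** (Re k ** S ** Re k)))
        \<longlonglongrightarrow> trace D + trace (matrix_inv D ** (R ** S ** R))"
    proof -
      have "(\<lambda>k. R + e k *\<^sub>R mat 1) \<longlonglongrightarrow> R + 0 *\<^sub>R mat 1" by (intro tendsto_intros e0)
      then have "Re \<longlonglongrightarrow> R" by (simp add: Re_def [abs_def])
      then show ?thesis by (intro tendsto_intros tendsto_trace tendsto_matrix_mult)
    qed
    ultimately have "2 * c \<le> trace D + trace (matrix_inv D ** (R ** S ** R))"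
      by (intro LIMSEQ_le_const) auto
    also have "matrix_inv D ** (R ** S ** R) = M - d *\<^sub>R (matrix_inv D ** M)"
    proof -
      have "matrix_inv D ** (D ** M) = M"
        using pd_mat_inv(2) [OF D] by (simp add: matrix_mul_assoc)
      also have "D ** M = M ** M + d *\<^sub>R M" by (simp add: D_def matrix_mult_bilinear_simps)
      finally show ?thesis by (simp add: M(2) matrix_mult_bilinear_simps algebra_simps)
    qed
    also have "trace \<dots> \<le> trace M"
      using trace_psd_mult_nonneg [OF pd_mat_inv_psd [OF D] M(1)] d
      by (simp add: trace_sub trace_scaleR)
    finally show ?thesis
      by (simp add: D_def trace_add trace_scaleR trace_mat_1)
  qed
  have "c \<le> trace M"
  proof (rule ccontr)
    assume "\<not> c \<le> trace M"
    then have g: "0 < 2 * c - 2 * trace M" by simp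
    \<comment> \<open>With \<open>n\<close> one larger than the dimension,
      \<open>d = (2 * c - 2 * trace M) / n\<close> makes the error term of \<open>bound\<close>
      strictly smaller than the gap.\<close>
    define n where "n = real CARD('n) + 1"
    have n: "0 < n" by (simp add: n_def)
    have "2 * c - 2 * trace M \<le> (2 * c - 2 * trace M) / n * (n - 1)"
      using bound [of "(2 * c - 2 * trace M) / n"] g n by (simp add: n_def)
    also have "\<dots> < 2 * c - 2 * trace M"
      using g n by (simp add: field_simps)
    finally show False by simp
  qed
  then show ?thesis by (simp add: M_def R_def)
qed

text \<open>The Fenchel-Young inequality for the quadratic form of \<open>T\<close> and its inverse,
  obtained from the form of \<open>T'\<close> at \<open>T y - x\<close>. It makes two quadratic
  functions admissible potentials in the Kantorovich dual.\<close>

lemma dual_pair_inner_le: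
  fixes T T' :: "real^'n^'n"
  assumes T: "psd_mat T" and T': "psd_mat T'" and inv: "T' ** T = mat 1"
  shows "2 * (x \<bullet> y) \<le> y \<bullet> (T *v y) + x \<bullet> (T' *v x)"
proof -
  have "0 \<le> (T *v y - x) \<bullet> (T' *v (T *v y - x))" using T' by (simp add: psd_mat_def)
  also have "T' *v (T *v y - x) = y - T' *v x"
    by (simp add: matrix_vector_mult_diff_distrib matrix_vector_mul_assoc inv)
  also have "(T *v y - x) \<bullet> (y - T' *v x)
      = (T *v y) \<bullet> y - (T *v y) \<bullet> (T' *v x) - x \<bullet> y + x \<bullet> (T' *v x)"
    by (simp add: algebra_simps)
  also have "(T *v y) \<bullet> (T' *v x) = x \<bullet> y"
    using inner_transpose [of "T *v y" T' x] T'
    by (simp add: psd_mat_def matrix_vector_mul_assoc inv inner_commute)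
  finally show ?thesis by (simp add: inner_commute)
qed

text \<open>Pairing \<open>T'\<close> with the Gram matrix of \<open>T ** R - X\<close> bounds twice
  the correlation of \<open>X\<close> with \<open>R\<close> by every dual value, hence by twice the
  fidelity. Expanding the Frobenius norm turns this into the claim. Any factor close to
  \<open>R\<close>, symmetric or not, thus certifies membership in a Gelbrich ball.\<close>

lemma gelbrich_sq_le_norm:
  fixes X S0 :: "real^'n^'n"
  assumes S0: "psd_mat S0"
  shows "gelbrich_sq (X ** transpose X) S0 \<le> (norm (X - msqrt S0))\<^sup>2"
proof -
  define R where "R = msqrt S0"
  have R: "R ** R = S0" "transpose R = R"
    using msqrt [OF S0] by (simp_all add: R_def)
  have "X \<bullet> R \<le> trace (msqrt (R ** (X ** transpose X) ** R))"
    unfolding R_def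
  proof (rule fidelity_dual_bound [OF psd_mat_mult_transpose S0])
    fix T T' :: "real^'n^'n" assume T: "psd_mat T" and T': "psd_mat T'" and inv: "T' ** T = mat 1"
    have inv2: "T ** T' = mat 1" using inv by (simp add: matrix_left_right_inverse)
    have "0 \<le> trace (T' ** ((T ** R - X) ** transpose (T ** R - X)))"
      by (intro trace_psd_mult_nonneg T' psd_mat_mult_transpose)
    also have "T' ** ((T ** R - X) ** transpose (T ** R - X))
        = (T' ** T) ** S0 ** T - (T' ** T) ** R ** transpose X - T' ** X ** R ** T + T' ** (X ** transpose X)"
      using T R by (simp add: transpose_linear_simps matrix_transpose_mul psd_mat_def
          matrix_mult_bilinear_simps matrix_mul_assoc flip: R(1))
    also have "trace \<dots> = trace (S0 ** T) - trace (R ** transpose X) - trace (T' ** X ** R ** T)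
        + trace (T' ** (X ** transpose X))"
      by (simp add: inv trace_add trace_sub)
    also have "trace (T' ** X ** R ** T) = trace (X ** R)"
      using trace_mul_sym [of "T' ** X ** R" T] by (simp add: matrix_mul_assoc inv2)
    also have "trace (X ** R) = X \<bullet> R"
      using trace_mul_sym [of X R] by (simp add: inner_eq_trace [of R X] R inner_commute [of X])
    also have "trace (R ** transpose X) = X \<bullet> R"
      using trace_mul_sym [of R "transpose X"] by (simp add: inner_eq_trace)
    also have "trace (S0 ** T) = trace (T ** S0)" by (rule trace_mul_sym)
    finally show "2 * (X \<bullet> msqrt S0) \<le> trace (T ** S0) + trace (T' ** (X ** transpose X))"
      by (simp add: R_def)
  qed
  moreover have "(norm (X - R))\<^sup>2 = trace (X ** transpose X) + trace S0 - 2 * (X \<bullet> R)"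
    using norm_eq_trace [of X] norm_eq_trace [of R]
    by (simp add: power2_norm_eq_inner R algebra_simps inner_commute)
  ultimately show ?thesis
    by (simp add: gelbrich_sq_def trace_add trace_sub trace_scaleR R_def [symmetric])
qed

text \<open>Let \<open>R\<close> and \<open>Q\<close> be the roots of \<open>S0\<close> and
  \<open>S\<close>. Conjugation with \<open>transpose K\<close> shows that
  \<open>R ** Q ** K\<close> is semidefinite. Being symmetric, its square equals its product with
  its own transpose, where \<open>K\<close> cancels and \<open>R ** S ** R\<close> remains. So it is
  the root in the fidelity, and its trace is the correlation of the factor with
  \<open>R\<close>.\<close>

lemma gelbrich_sq_eq_norm:
  fixes S S0 K :: "real^'n^'n"
  assumes S: "psd_mat S" and S0: "psd_mat S0" and K: "orthogonal_matrix K"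
    and psd: "psd_mat (K ** msqrt S0 ** msqrt S)"
  shows "gelbrich_sq S S0 = (norm (msqrt S ** K - msqrt S0))\<^sup>2"
    and "(msqrt S ** K) ** transpose (msqrt S ** K) = S"
proof -
  define R where "R = msqrt S0"
  define Q where "Q = msqrt S"
  have R: "R ** R = S0" "transpose R = R"
    using msqrt [OF S0] by (simp_all add: R_def)
  have Q: "Q ** Q = S" "transpose Q = Q"
    using msqrt [OF S] by (simp_all add: Q_def)
  have KK: "K ** transpose K = mat 1" "transpose K ** K = mat 1"
    using K by (simp_all add: orthogonal_matrix_def)
  have RQK: "transpose K ** (K ** R ** Q) ** K = R ** Q ** K"
  proof -
    have "transpose K ** (K ** R ** Q) ** K = (transpose K ** K) ** R ** Q ** K"
      by (simp only: matrix_mul_assoc)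
    then show ?thesis by (simp add: KK)
  qed
  have psd': "psd_mat (R ** Q ** K)"
    using psd_mat_conj [OF psd, of "transpose K"] by (simp add: RQK flip: R_def Q_def)
  have "msqrt (R ** S ** R) = R ** Q ** K"
  proof (rule msqrt_eqI [OF psd'])
    have "(R ** Q ** K) ** (R ** Q ** K) = (R ** Q ** K) ** transpose (R ** Q ** K)"
      using psd_mat_symmetric [OF psd'] by simp
    also have "\<dots> = R ** Q ** (K ** transpose K) ** Q ** R"
      by (simp add: matrix_transpose_mul R Q matrix_mul_assoc)
    also have "\<dots> = R ** S ** R"
      by (simp add: KK matrix_mul_assoc flip: Q(1))
    finally show "(R ** Q ** K) ** (R ** Q ** K) = R ** S ** R" .
  qed
  moreover have "trace (R ** Q ** K) = (Q ** K) \<bullet> R"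
    by (subst inner_commute) (simp add: inner_eq_trace R matrix_mul_assoc)
  moreover show X: "(msqrt S ** K) ** transpose (msqrt S ** K) = S"
  proof -
    have "(Q ** K) ** transpose (Q ** K) = Q ** (K ** transpose K) ** Q"
      by (simp add: matrix_transpose_mul Q matrix_mul_assoc)
    then show ?thesis by (simp add: KK Q flip: Q_def)
  qed
  moreover have "(norm (Q ** K - R))\<^sup>2 = trace S + trace S0 - 2 * ((Q ** K) \<bullet> R)"
    using norm_eq_trace [of "Q ** K"] norm_eq_trace [of R] X [folded Q_def]
    by (simp add: power2_norm_eq_inner R algebra_simps inner_commute)
  ultimately show "gelbrich_sq S S0 = (norm (msqrt S ** K - msqrt S0))\<^sup>2"
    by (simp add: gelbrich_sq_def trace_add trace_sub trace_scaleR R_def [symmetric] Q_def [symmetric])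
qed

lemma gelbrich_sq_attained:
  fixes S S0 :: "real^'n^'n"
  assumes S: "psd_mat S" and S0: "psd_mat S0"
  obtains K where "orthogonal_matrix K"
    "gelbrich_sq S S0 = (norm (msqrt S ** K - msqrt S0))\<^sup>2"
    "(msqrt S ** K) ** transpose (msqrt S ** K) = S"
proof -
  have "loewner_ge (msqrt S0 ** msqrt S0) (0 *\<^sub>R mat 1)"
    using S0 by (simp add: loewner_ge_def msqrt)
  then obtain K where K: "orthogonal_matrix K" "psd_mat (K ** msqrt S0 ** msqrt S)"
    by (rule orthogonal_alignment [OF msqrt_psd [OF S0] msqrt_psd [OF S] order_refl]) auto
  show thesis by (rule that [OF K(1) gelbrich_sq_eq_norm [OF S S0 K]])
qed

section \<open>Enlarging a covariance inside a Gelbrich ball\<close>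

lemma msqrt_eigenvector:
  assumes S: "psd_mat S" and v: "S *v v = m *\<^sub>R v" and m: "0 \<le> m"
  shows "msqrt S *v v = sqrt m *\<^sub>R v"
proof -
  define Q where "Q = msqrt S"
  have Q: "psd_mat Q" "Q ** Q = S" "transpose Q = Q"
    using msqrt [OF S] by (simp_all add: Q_def)
  \<comment> \<open>If nonzero, \<open>w\<close> is an eigenvector of \<open>Q\<close> for
    \<open>- sqrt m\<close>. Semidefiniteness excludes this for positive \<open>m\<close>; for
    \<open>m = 0\<close> the norm of \<open>Q v\<close> is computed directly.\<close>
  define w where "w = Q *v v - sqrt m *\<^sub>R v"
  have QQ: "Q *v (Q *v v) = m *\<^sub>R v" using v by (simp add: matrix_vector_mul_assoc Q)
  have Qw: "Q *v w = - (sqrt m *\<^sub>R w)"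
    using m by (simp add: w_def matrix_vector_mult_diff_distrib QQ matrix_vector_mult_scaleR algebra_simps)
  have "w = 0"
  proof (cases "m = 0")
    case True
    then have "w \<bullet> w = (Q *v v) \<bullet> (Q *v v)" by (simp add: w_def)
    also have "\<dots> = v \<bullet> (Q *v (Q *v v))" by (simp add: inner_transpose [of v] Q)
    also have "\<dots> = 0" using QQ True by simp
    finally show ?thesis by simp
  next
    case False
    have "0 \<le> w \<bullet> (Q *v w)" using Q by (simp add: psd_mat_def)
    then have "sqrt m * (w \<bullet> w) \<le> 0" by (simp add: Qw)
    moreover have "0 < sqrt m" using m False by simp
    ultimately have "w \<bullet> w \<le> 0" by (simp add: mult_le_0_iff)
    then have "w \<bullet> w = 0" using inner_ge_zero [of w] by linarith
    then show ?thesis by simp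
  qed
  then show ?thesis by (simp add: w_def Q_def)
qed

definition outer :: "real^'n \<Rightarrow> real^'n^'n" where
  "outer v = (\<chi> i j. v $ i * v $ j)"

lemma outer_mult_vec: "outer v *v x = (v \<bullet> x) *\<^sub>R v"
  by (simp add: outer_def matrix_vector_mult_def vec_eq_iff inner_vec_def sum_distrib_left algebra_simps)

lemma transpose_outer: "transpose (outer v) = outer v"
  by (simp add: outer_def transpose_def vec_eq_iff mult.commute)

lemma psd_mat_outer: "psd_mat (outer v)"
  by (simp add: psd_mat_def transpose_outer outer_mult_vec inner_commute)

lemma trace_mult_outer: "trace (A ** outer v) = v \<bullet> (A *v v)"
proof -
  have "trace (A ** outer v) = (\<Sum>i\<in>UNIV. \<Sum>k\<in>UNIV. A $ i $ k * (v $ k * v $ i))"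
    by (simp add: trace_def matrix_matrix_mult_def outer_def)
  then show ?thesis
    by (simp add: inner_vec_def matrix_vector_mult_def sum_distrib_left algebra_simps)
qed

lemma mult_outer_eigenvector:
  assumes "transpose Q = Q" "Q *v v = m *\<^sub>R v"
  shows "Q ** outer v = m *\<^sub>R outer v" "outer v ** Q = m *\<^sub>R outer v"
proof -
  show *: "Q ** outer v = m *\<^sub>R outer v"
    by (simp add: matrix_eq outer_mult_vec assms matrix_vector_mult_scaleR
        flip: matrix_vector_mul_assoc scaleR_matrix_vector_assoc)
  have "transpose (Q ** outer v) = transpose (m *\<^sub>R outer v)" by (simp only: *)
  then show "outer v ** Q = m *\<^sub>R outer v"
    by (simp add: matrix_transpose_mul transpose_outer assms transpose_linear_simps)
qed

text \<open>If \<open>S'\<close> had an eigenvalue \<open>m < lam\<close> with unit eigenvector \<open>v\<close>, increasing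
  \<open>sqrt m\<close> to \<open>sqrt m + r\<close> along \<open>v\<close> in the square root would raise the trace by \<open>2 r sqrt m + r^2\<close>
  but also the correlation with the reference by at least \<open>r sqrt lam\<close>; for
  \<open>r = 2 (sqrt lam - sqrt m)\<close> the distance does not grow, contradicting the maximality of the trace of \<open>S'\<close>.\<close>

lemma gelbrich_ball_dominated:
  fixes S S0 :: "real^'n^'n"
  assumes S: "psd_mat S" and S0: "psd_mat S0" and lam: "0 \<le> lam"
    and ge: "loewner_ge S0 (lam *\<^sub>R mat 1)" and ball: "gelbrich_sq S S0 \<le> \<rho>\<^sup>2" and \<rho>: "0 \<le> \<rho>"
  obtains S' where "psd_mat S'" "loewner_ge S' S" "loewner_ge S' (lam *\<^sub>R mat 1)"
    "gelbrich_sq S' S0 \<le> \<rho>\<^sup>2"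
proof -
  define R where "R = msqrt S0"
  have R: "psd_mat R" "R ** R = S0" "transpose R = R"
    using msqrt [OF S0] by (simp_all add: R_def)
  \<comment> \<open>The trace is a scalar substitute for the Loewner order: a trace maximiser among
    the factors in the ball that dominate \<open>S\<close> cannot be enlarged within the
    ball.\<close>
  define C where "C = cball R \<rho> \<inter> {X. psd_mat (X ** transpose X - S)}"
  have "closed ((\<lambda>X :: real^'n^'n. X ** transpose X - S) -` {A. psd_mat A})"
    by (intro closed_vimage closed_psd_mat continuous_intros)
  then have "compact C" unfolding C_def by (auto simp: vimage_def intro: compact_Int_closed)
  moreover have "C \<noteq> {}"
  proof -
    obtain K where K: "gelbrich_sq S S0 = (norm (msqrt S ** K - msqrt S0))\<^sup>2"
      "(msqrt S ** K) ** transpose (msqrt S ** K) = S"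
      using gelbrich_sq_attained [OF S S0] by metis
    have "norm (msqrt S ** K - R) \<le> \<rho>"
      using ball K(1) \<rho> by (simp add: R_def abs_le_square_iff [symmetric])
    then have "msqrt S ** K \<in> C" using K(2) by (simp add: C_def dist_norm norm_minus_commute psd_mat_0)
    then show ?thesis by blast
  qed
  moreover have "continuous_on C (\<lambda>X. trace (X ** transpose X))" by (intro continuous_intros)
  ultimately obtain X where X: "X \<in> C" "\<And>Y. Y \<in> C \<Longrightarrow> trace (Y ** transpose Y) \<le> trace (X ** transpose X)"
    using continuous_attains_sup [of C "\<lambda>X. trace (X ** transpose X)"] by blast
  define S' where "S' = X ** transpose X"
  have S': "psd_mat S'" unfolding S'_def by (rule psd_mat_mult_transpose)
  have S'S: "psd_mat (S' - S)" using X(1) by (simp add: C_def S'_def)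
  have ball': "gelbrich_sq S' S0 \<le> \<rho>\<^sup>2"
  proof -
    have "norm (X - R) \<le> \<rho>" using X(1) by (simp add: C_def dist_norm norm_minus_commute)
    then have "(norm (X - R))\<^sup>2 \<le> \<rho>\<^sup>2" by (simp add: power_mono)
    then show ?thesis using gelbrich_sq_le_norm [OF S0, of X] by (simp add: S'_def R_def)
  qed
  have "psd_mat (S' - lam *\<^sub>R mat 1)"
  proof (rule psd_mat_eigenvaluesI)
    show "transpose (S' - lam *\<^sub>R mat 1) = S' - lam *\<^sub>R mat 1"
      using psd_mat_symmetric [OF S'] by (simp add: transpose_linear_simps)
    fix v :: "real^'n" and l assume v: "norm v = 1" "(S' - lam *\<^sub>R mat 1) *v v = l *\<^sub>R v"
    show "0 \<le> l"
    proof (rule ccontr)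
      assume l: "\<not> 0 \<le> l"
      define m where "m = lam + l"
      have vv: "v \<bullet> v = 1" using v by (simp add: norm_eq_1)
      have Sv: "S' *v v = m *\<^sub>R v"
        using v(2) by (simp add: matrix_vector_mult_diff_rdistrib m_def algebra_simps
            flip: scaleR_matrix_vector_assoc)
      have "0 \<le> v \<bullet> (S' *v v)" using S' by (simp add: psd_mat_def)
      then have m: "0 \<le> m" "m < lam" using l by (simp_all add: Sv vv m_def)
      define Q where "Q = msqrt S'"
      have Q: "psd_mat Q" "Q ** Q = S'" "transpose Q = Q"
        using msqrt [OF S'] by (simp_all add: Q_def)
      have Qv: "Q *v v = sqrt m *\<^sub>R v" unfolding Q_def by (rule msqrt_eigenvector [OF S' Sv m(1)])
      have "loewner_ge (R ** R) (lam *\<^sub>R mat 1)" using ge R by simp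
      then obtain K where K: "orthogonal_matrix K" "psd_mat (K ** R ** Q)"
        and align: "\<forall>v m. Q *v v = m *\<^sub>R v \<longrightarrow> sqrt lam * (norm v)\<^sup>2 \<le> v \<bullet> ((K ** R) *v v)"
        by (rule orthogonal_alignment [OF R(1) Q(1) lam])
      note G = gelbrich_sq_eq_norm [OF S' S0 K(1), folded R_def Q_def, OF K(2)]
      have KR: "sqrt lam \<le> v \<bullet> ((K ** R) *v v)" using align [rule_format, OF Qv] v by simp
      define r where "r = 2 * (sqrt lam - sqrt m)"
      have r: "0 < r" using m by (simp add: r_def)
      define t where "t = 2 * r * sqrt m + r\<^sup>2"
      have t: "0 < t" using r m by (simp add: t_def add_nonneg_pos)
      \<comment> \<open>The rotation \<open>K\<close> is kept, so perturbing the root along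
        \<open>v\<close> changes the correlation with \<open>R\<close> by \<open>r\<close> times the
        quantity bounded in \<open>KR\<close>.\<close>
      define Y where "Y = (Q + r *\<^sub>R outer v) ** K"
      have KK: "K ** transpose K = mat 1" using K by (simp add: orthogonal_matrix_def)
      have oo: "outer v ** outer v = outer v"
        using mult_outer_eigenvector(1) [OF transpose_outer, of v v 1] by (simp add: outer_mult_vec vv)
      have YY: "Y ** transpose Y = S' + t *\<^sub>R outer v"
      proof -
        have "Y ** transpose Y = (Q + r *\<^sub>R outer v) ** (K ** transpose K) ** (Q + r *\<^sub>R outer v)"
          by (simp add: Y_def matrix_transpose_mul transpose_linear_simps transpose_outer Q matrix_mul_assoc)
        also have "\<dots> = S' + (r * sqrt m) *\<^sub>R outer v + (r * sqrt m) *\<^sub>R outer v + (r * r) *\<^sub>R outer v"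
          by (simp add: KK matrix_mult_bilinear_simps Q mult_outer_eigenvector [OF Q(3) Qv] oo algebra_simps)
        also have "\<dots> = S' + t *\<^sub>R outer v"
          by (simp add: t_def power2_eq_square algebra_simps flip: scaleR_left_distrib)
        finally show ?thesis .
      qed
      have tr: "trace (Y ** transpose Y) = trace S' + t"
        using trace_mult_outer [of "mat 1" v] by (simp add: YY trace_add trace_scaleR vv)
      have "Y \<in> C"
      proof -
        have "Y \<bullet> R = (Q ** K) \<bullet> R + r * ((outer v ** K) \<bullet> R)"
          by (simp add: Y_def matrix_mult_bilinear_simps inner_add_left)
        also have "(outer v ** K) \<bullet> R = v \<bullet> ((K ** R) *v v)"
        proof -
          have "(outer v ** K) \<bullet> R = trace (R ** (outer v ** K))"
            by (subst inner_commute) (simp add: inner_eq_trace R)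
          also have "\<dots> = trace (K ** R ** outer v)"
            using trace_mul_sym [of "R ** outer v" K] by (simp add: matrix_mul_assoc)
          finally show ?thesis by (simp add: trace_mult_outer)
        qed
        finally have "(Q ** K) \<bullet> R + r * sqrt lam \<le> Y \<bullet> R" using KR r by simp
        moreover have n: "(norm (Z - R))\<^sup>2 = trace (Z ** transpose Z) + trace S0 - 2 * (Z \<bullet> R)" for Z
          using norm_eq_trace [of Z] norm_eq_trace [of R]
          by (simp add: power2_norm_eq_inner R algebra_simps inner_commute)
        ultimately have "(norm (Y - R))\<^sup>2 \<le> (norm (Q ** K - R))\<^sup>2 + t - 2 * (r * sqrt lam)"
          using n [of Y] n [of "Q ** K"] G(2) tr by simp
        \<comment> \<open>This equation determines \<open>r\<close>: the added trace is paid for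
          exactly by the guaranteed gain in correlation, so \<open>Y\<close> stays in the ball even
          if the old factor lies on its boundary.\<close>
        moreover have "t = 2 * (r * sqrt lam)"
          by (simp add: t_def r_def power2_eq_square algebra_simps)
        ultimately have "(norm (Y - R))\<^sup>2 \<le> \<rho>\<^sup>2" using ball' G(1) by linarith
        then have "norm (Y - R) \<le> \<rho>" using \<rho> by (rule power2_le_imp_le)
        moreover have "psd_mat (Y ** transpose Y - S)"
          using psd_mat_add [OF S'S psd_mat_scaleR [OF psd_mat_outer [of v], of t]] t
          by (simp add: YY algebra_simps)
        ultimately show ?thesis by (simp add: C_def dist_norm norm_minus_commute)
      qed
      from X(2) [OF this] show False using tr t by (simp add: S'_def)
    qed
  qed
  then show thesis using that [of S'] S' S'S ball' by (simp add: loewner_ge_def)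
qed

section \<open>The mean squared error of linear estimators\<close>

text \<open>The centred error of the estimator with gain \<open>A\<close> is
  \<open>(mat 1 - A ** H) x - A w\<close>, and independence adds the two traces. For fixed
  \<open>A\<close> no inverse occurs and the dependence on the covariances is linear.\<close>

definition linear_mse :: "real^'n^'m \<Rightarrow> real^'m^'n \<Rightarrow> real^'n^'n \<Rightarrow> real^'m^'m \<Rightarrow> real" where
  "linear_mse H A Sx Sw =
    trace ((mat 1 - A ** H) ** Sx ** transpose (mat 1 - A ** H) + A ** Sw ** transpose A)"

definition gain :: "real^'n^'m \<Rightarrow> real^'n^'n \<Rightarrow> real^'m^'m \<Rightarrow> real^'m^'n" where
  "gain H Sx Sw = Sx ** transpose H ** matrix_inv (H ** Sx ** transpose H + Sw)"

lemma pd_mat_observation: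
  assumes "psd_mat Sx" "pd_mat Sw"
  shows "pd_mat (H ** Sx ** transpose H + Sw)"
  using assms by (intro pd_mat_add psd_mat_conj)

text \<open>Completing the square in \<open>A\<close>: the gain solves the normal equation
  \<open>gain H Sx Sw ** G = Sx ** transpose H\<close>, which absorbs the cross terms. This exhibits
  \<open>mmse_obj\<close> as a minimum over \<open>A\<close>, so order and limit properties follow
  without analysing the inverse.\<close>

lemma linear_mse_eq:
  fixes H :: "real^'n^'m"
  assumes Sx: "psd_mat Sx" and Sw: "pd_mat Sw"
  defines "G \<equiv> H ** Sx ** transpose H + Sw"
  shows "linear_mse H A Sx Sw = mmse_obj H Sx Sw
    + trace ((A - gain H Sx Sw) ** G ** transpose (A - gain H Sx Sw))"
proof -
  have G: "pd_mat G" unfolding G_def using Sx Sw by (rule pd_mat_observation)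
  let ?I = "matrix_inv G" and ?B = "gain H Sx Sw"
  have B: "?B = Sx ** transpose H ** ?I" by (simp add: gain_def G_def)
  have tB: "transpose ?B = ?I ** H ** Sx"
    by (simp add: B matrix_transpose_mul pd_mat_inv_transpose [OF G] psd_mat_symmetric [OF Sx] matrix_mul_assoc)
  have BG: "?B ** G = Sx ** transpose H"
    using pd_mat_inv(2) [OF G] by (simp add: B flip: matrix_mul_assoc)
  have GB: "G ** transpose ?B = H ** Sx"
    using pd_mat_inv(1) [OF G] by (simp add: tB matrix_mul_assoc)
  have "(A - ?B) ** G ** transpose (A - ?B)
      = A ** G ** transpose A - A ** (G ** transpose ?B) - ?B ** G ** transpose A + ?B ** G ** transpose ?B"
    by (simp add: transpose_linear_simps matrix_mult_bilinear_simps matrix_mul_assoc)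
  also have "\<dots> = A ** G ** transpose A - A ** H ** Sx - Sx ** transpose H ** transpose A
      + Sx ** transpose H ** ?I ** H ** Sx"
    unfolding GB unfolding BG tB by (simp add: matrix_mul_assoc)
  finally have 1: "(A - ?B) ** G ** transpose (A - ?B) = \<dots>" .
  have "(mat 1 - A ** H) ** Sx ** transpose (mat 1 - A ** H) + A ** Sw ** transpose A
     = (Sx - Sx ** transpose H ** ?I ** H ** Sx) + (A - ?B) ** G ** transpose (A - ?B)"
    unfolding 1 by (simp add: G_def transpose_linear_simps matrix_mult_bilinear_simps matrix_mul_assoc
        matrix_transpose_mul)
  then show ?thesis by (simp add: linear_mse_def mmse_obj_def G_def trace_add)
qed

lemma mmse_obj_le_linear_mse:
  assumes "psd_mat Sx" "pd_mat Sw"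
  shows "mmse_obj H Sx Sw \<le> linear_mse H A Sx Sw"
  unfolding linear_mse_eq [OF assms]
  using assms by (simp add: psd_mat_trace_nonneg psd_mat_conj pd_imp_psd_mat pd_mat_observation)

lemma linear_mse_gain:
  assumes "psd_mat Sx" "pd_mat Sw"
  shows "linear_mse H (gain H Sx Sw) Sx Sw = mmse_obj H Sx Sw"
  unfolding linear_mse_eq [OF assms]
  by (simp add: matrix_mult_bilinear_simps psd_mat_trace_nonneg trace_def)

lemma linear_mse_mono:
  assumes "loewner_ge Sx' Sx" "loewner_ge Sw' Sw"
  shows "linear_mse H A Sx Sw \<le> linear_mse H A Sx' Sw'"
proof -
  have "0 \<le> linear_mse H A (Sx' - Sx) (Sw' - Sw)"
    using assms unfolding linear_mse_def loewner_ge_def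
    by (intro psd_mat_trace_nonneg psd_mat_add psd_mat_conj)
  also have "\<dots> = linear_mse H A Sx' Sw' - linear_mse H A Sx Sw"
    by (simp add: linear_mse_def matrix_mult_bilinear_simps trace_add trace_sub)
  finally show ?thesis by simp
qed

text \<open>The optimal gain of the larger pair is used for the smaller pair, where it is merely a
  candidate.\<close>

lemma mmse_obj_mono:
  assumes "psd_mat Sx" "pd_mat Sw" "psd_mat Sx'" "pd_mat Sw'" "loewner_ge Sx' Sx" "loewner_ge Sw' Sw"
  shows "mmse_obj H Sx Sw \<le> mmse_obj H Sx' Sw'"
proof -
  have "mmse_obj H Sx Sw \<le> linear_mse H (gain H Sx' Sw') Sx Sw"
    using assms by (intro mmse_obj_le_linear_mse)
  also have "\<dots> \<le> linear_mse H (gain H Sx' Sw') Sx' Sw'"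
    using assms by (intro linear_mse_mono)
  also have "\<dots> = mmse_obj H Sx' Sw'" using assms by (intro linear_mse_gain)
  finally show ?thesis .
qed

section \<open>The standard normal law on a Euclidean space\<close>

lemma borel_measurable_linear:
  fixes f :: "'a::euclidean_space \<Rightarrow> 'b::euclidean_space"
  assumes "linear f"
  shows "f \<in> borel_measurable borel"
  using assms by (intro borel_measurable_continuous_onI linear_continuous_on)
    (simp add: linear_conv_bounded_linear)

lemma nn_integral_lborel_shift:
  fixes g :: "'a::euclidean_space \<Rightarrow> ennreal"
  assumes [measurable]: "g \<in> borel_measurable borel"
  shows "(\<integral>\<^sup>+x. g (x + c) \<partial>lborel) = (\<integral>\<^sup>+x. g x \<partial>lborel)"
    and "(\<integral>\<^sup>+x. g (c - x) \<partial>lborel) = (\<integral>\<^sup>+x. g x \<partial>lborel)"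
proof -
  have "(\<integral>\<^sup>+x. g x \<partial>lborel) = (\<integral>\<^sup>+x. g x \<partial>distr lborel borel ((+) c))"
    by (simp add: lborel_distr_plus)
  also have "\<dots> = (\<integral>\<^sup>+x. g (c + x) \<partial>lborel)"
    by (subst nn_integral_distr) auto
  finally show "(\<integral>\<^sup>+x. g (x + c) \<partial>lborel) = (\<integral>\<^sup>+x. g x \<partial>lborel)"
    by (simp add: add.commute)
  have "(\<integral>\<^sup>+x. g x \<partial>lborel) = (\<integral>\<^sup>+x. g x \<partial>distr lborel borel (\<lambda>x. c + (- 1) *\<^sub>R x))"
    by (subst lborel_affine [of "- 1" c]) (simp_all add: density_1)
  also have "\<dots> = (\<integral>\<^sup>+x. g (c - x) \<partial>lborel)"
    by (subst nn_integral_distr) auto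
  finally show "(\<integral>\<^sup>+x. g (c - x) \<partial>lborel) = (\<integral>\<^sup>+x. g x \<partial>lborel)" by simp
qed

text \<open>Uniqueness of Haar measure in disguise: integrating \<open>N (x + f y) g (f y)\<close> in both orders,
  with \<open>N\<close> the indicator of the unit ball, shows that both sides agree after multiplication with the
  volume of the ball.\<close>

lemma nn_integral_lborel_orthogonal:
  fixes f :: "'a::euclidean_space \<Rightarrow> 'a"
  assumes f: "orthogonal_transformation f" and [measurable]: "g \<in> borel_measurable borel"
  shows "(\<integral>\<^sup>+y. g (f y) \<partial>lborel) = (\<integral>\<^sup>+y. g y \<partial>lborel)"
proof -
  define N :: "'a \<Rightarrow> ennreal" where "N = indicator (cball 0 1)"
  have [measurable]: "N \<in> borel_measurable borel" by (simp add: N_def borel_measurable_indicator borel_closed)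
  have lin: "linear f" using f by (rule orthogonal_transformation_linear)
  have [measurable]: "f \<in> borel_measurable borel"
    using lin by (rule borel_measurable_linear)
  define f' where "f' = inv f"
  have f': "f (f' x) = x" for x
    using orthogonal_transformation_surj [OF f] by (simp add: f'_def surj_f_inv_f)
  let ?V = "\<integral>\<^sup>+x. N x \<partial>lborel"
  have V: "?V = emeasure lborel (cball 0 1 :: 'a set)" by (simp add: N_def)
  have V0: "?V \<noteq> 0"
    using content_cball_pos [of 1 "0 :: 'a"] unfolding V by (auto simp: measure_def)
  have Vt: "?V \<noteq> \<top>"
    unfolding V by (metis emeasure_lborel_cball_finite infinity_ennreal_def less_irrefl)
  have "?V * (\<integral>\<^sup>+y. g (f y) \<partial>lborel) = (\<integral>\<^sup>+y. (\<integral>\<^sup>+x. N (x + f y) \<partial>lborel) * g (f y) \<partial>lborel)"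
    by (simp add: nn_integral_lborel_shift nn_integral_cmult)
  also have "\<dots> = (\<integral>\<^sup>+y. (\<integral>\<^sup>+x. N (x + f y) * g (f y) \<partial>lborel) \<partial>lborel)"
    by (intro nn_integral_cong) (simp add: nn_integral_multc)
  also have "\<dots> = (\<integral>\<^sup>+x. (\<integral>\<^sup>+y. N (x + f y) * g (f y) \<partial>lborel) \<partial>lborel)"
    by (rule lborel_pair.Fubini') measurable
  also have "\<dots> = (\<integral>\<^sup>+x. (\<integral>\<^sup>+y. N (f y) * g (f y - x) \<partial>lborel) \<partial>lborel)"
  proof (rule nn_integral_cong)
    \<comment> \<open>Translating \<open>y\<close> by \<open>- f' x\<close> moves \<open>f y\<close>
      by \<open>- x\<close>; surjectivity of \<open>f\<close> provides the preimage
      \<open>f' x\<close>.\<close>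
    fix x
    have "(\<integral>\<^sup>+y. N (x + f y) * g (f y) \<partial>lborel)
        = (\<integral>\<^sup>+y. N (x + f (y + - f' x)) * g (f (y + - f' x)) \<partial>lborel)"
      by (rule nn_integral_lborel_shift(1) [symmetric]) measurable
    also have "\<dots> = (\<integral>\<^sup>+y. N (f y) * g (f y - x) \<partial>lborel)"
      by (simp add: linear_diff [OF lin] f')
    finally show "(\<integral>\<^sup>+y. N (x + f y) * g (f y) \<partial>lborel) = (\<integral>\<^sup>+y. N (f y) * g (f y - x) \<partial>lborel)" .
  qed
  also have "\<dots> = (\<integral>\<^sup>+y. (\<integral>\<^sup>+x. N (f y) * g (f y - x) \<partial>lborel) \<partial>lborel)"
    by (rule lborel_pair.Fubini' [symmetric]) measurable
  also have "\<dots> = (\<integral>\<^sup>+y. N (f y) * (\<integral>\<^sup>+x. g x \<partial>lborel) \<partial>lborel)"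
    by (intro nn_integral_cong) (simp add: nn_integral_cmult nn_integral_lborel_shift)
  also have "\<dots> = ?V * (\<integral>\<^sup>+x. g x \<partial>lborel)"
    using f by (simp add: nn_integral_multc N_def indicator_def orthogonal_transformation)
  finally show ?thesis using V0 Vt by (simp add: ennreal_mult_cancel_left)
qed

text \<open>Defined on every Euclidean space and not only on vectors, so that signal and noise
  together are driven by one standard normal variable on a product space.\<close>

definition sgauss :: "'a::euclidean_space measure" where
  "sgauss = density lborel (\<lambda>z. ennreal (\<Prod>b\<in>Basis. std_normal_density (z \<bullet> b)))"

text \<open>As a function of the norm alone the density is constant on spheres, which is the source
  of the orthogonal invariance.\<close>

lemma sgauss_density:
  "(\<Prod>b\<in>Basis. std_normal_density (z \<bullet> b))
    = (1 / sqrt (2 * pi)) ^ DIM('a) * exp (- (norm z)\<^sup>2 / 2)" for z :: "'a::euclidean_space"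
proof -
  have "(\<Prod>b\<in>Basis. std_normal_density (z \<bullet> b))
      = (1 / sqrt (2 * pi)) ^ DIM('a) * (\<Prod>b\<in>Basis. exp (- (z \<bullet> b)\<^sup>2 / 2))"
    by (simp add: std_normal_density_def prod.distrib prod_dividef power_divide)
  also have "(\<Prod>b\<in>Basis. exp (- (z \<bullet> b)\<^sup>2 / 2)) = exp (\<Sum>b\<in>Basis. - (z \<bullet> b)\<^sup>2 / 2)"
    by (simp add: exp_sum)
  also have "(\<Sum>b\<in>Basis. - (z \<bullet> b)\<^sup>2 / 2) = - (norm z)\<^sup>2 / 2"
    unfolding power2_norm_eq_inner
    by (subst euclidean_inner) (simp add: sum_negf power2_eq_square flip: sum_divide_distrib)
  finally show ?thesis .
qed

lemma sets_sgauss [simp, measurable_cong]: "sets sgauss = sets borel"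
  by (simp add: sgauss_def)

lemma space_sgauss [simp]: "space sgauss = UNIV"
  by (simp add: sgauss_def)

lemma nn_integral_std_normal:
  "(\<integral>\<^sup>+x. ennreal (std_normal_density x) \<partial>lborel) = 1"
  "(\<integral>\<^sup>+x. ennreal (std_normal_density x) * ennreal (x\<^sup>2) \<partial>lborel) = 1"
proof -
  have "has_bochner_integral lborel (\<lambda>x. std_normal_density x) 1"
    using std_normal_moment_even [of 0] by simp
  then show "(\<integral>\<^sup>+x. ennreal (std_normal_density x) \<partial>lborel) = 1"
    by (simp add: has_bochner_integral_iff nn_integral_eq_integral)
  have "has_bochner_integral lborel (\<lambda>x. std_normal_density x * x\<^sup>2) 1"
    using std_normal_moment_even [of 1] by (simp add: fact_numeral)
  then have "(\<integral>\<^sup>+x. ennreal (std_normal_density x * x\<^sup>2) \<partial>lborel) = 1"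
    by (subst nn_integral_eq_integral) (auto simp: has_bochner_integral_iff)
  then show "(\<integral>\<^sup>+x. ennreal (std_normal_density x) * ennreal (x\<^sup>2) \<partial>lborel) = 1"
    by (simp add: ennreal_mult)
qed

lemma nn_integral_sgauss_prod:
  fixes h :: "'a::euclidean_space \<Rightarrow> real \<Rightarrow> ennreal"
  assumes [measurable]: "\<And>b. b \<in> Basis \<Longrightarrow> h b \<in> borel_measurable borel"
  shows "(\<integral>\<^sup>+z. (\<Prod>b\<in>Basis. h b (z \<bullet> b)) \<partial>sgauss)
    = (\<Prod>b\<in>Basis. \<integral>\<^sup>+x. ennreal (std_normal_density x) * h b x \<partial>lborel)"
proof -
  have "(\<integral>\<^sup>+z. (\<Prod>b\<in>Basis. h b (z \<bullet> b)) \<partial>sgauss)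
      = (\<integral>\<^sup>+z. (\<Prod>b\<in>Basis. ennreal (std_normal_density (z \<bullet> b)) * h b (z \<bullet> b)) \<partial>lborel)"
    unfolding sgauss_def by (subst nn_integral_density) (simp_all add: prod.distrib prod_ennreal)
  also have "\<dots> = (\<Prod>b\<in>Basis. \<integral>\<^sup>+x. ennreal (std_normal_density x) * h b x \<partial>lborel)"
    by (subst nn_integral_lborel_prod [of "\<lambda>b x. ennreal (std_normal_density x) * h b x"]) simp_all
  finally show ?thesis .
qed

lemma prob_space_sgauss: "prob_space (sgauss :: 'a::euclidean_space measure)"
proof
  have "emeasure sgauss (space (sgauss :: 'a measure)) = (\<integral>\<^sup>+z. (\<Prod>b\<in>(Basis :: 'a set). 1) \<partial>(sgauss :: 'a measure))"
    by simp
  also have "\<dots> = 1"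
    by (subst nn_integral_sgauss_prod [of "\<lambda>_ _. 1"]) (simp_all add: nn_integral_std_normal)
  finally show "emeasure sgauss (space (sgauss :: 'a measure)) = 1" .
qed

lemma distr_sgauss_orthogonal:
  fixes f :: "'a::euclidean_space \<Rightarrow> 'a"
  assumes f: "orthogonal_transformation f"
  shows "distr sgauss borel f = sgauss"
proof (rule measure_eqI)
  have [measurable]: "f \<in> borel_measurable borel"
    using orthogonal_transformation_linear [OF f] by (rule borel_measurable_linear)
  fix A assume "A \<in> sets (distr sgauss borel f)"
  then have [measurable]: "A \<in> sets borel" by simp
  have "emeasure (distr sgauss borel f) A = (\<integral>\<^sup>+z. indicator A z \<partial>distr sgauss borel f)"
    by simp
  also have "\<dots> = (\<integral>\<^sup>+z. indicator A (f z) \<partial>sgauss)"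
    by (rule nn_integral_distr) simp_all
  also have "\<dots> = (\<integral>\<^sup>+z. ennreal (\<Prod>b\<in>Basis. std_normal_density (f z \<bullet> b)) * indicator A (f z) \<partial>lborel)"
    using f unfolding sgauss_def
    by (subst nn_integral_density) (simp_all add: sgauss_density orthogonal_transformation)
  also have "\<dots> = (\<integral>\<^sup>+z. ennreal (\<Prod>b\<in>Basis. std_normal_density (z \<bullet> b)) * indicator A z \<partial>lborel)"
    by (rule nn_integral_lborel_orthogonal [OF f]) measurable
  also have "\<dots> = (\<integral>\<^sup>+z. indicator A z \<partial>sgauss)"
    unfolding sgauss_def by (subst nn_integral_density) simp_all
  finally show "emeasure (distr sgauss borel f) A = emeasure sgauss A" by simp
qed simp

lemma integral_sgauss_orthogonal:
  fixes f :: "'a::euclidean_space \<Rightarrow> 'a" and h :: "'a \<Rightarrow> real"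
  assumes f: "orthogonal_transformation f" and [measurable]: "h \<in> borel_measurable borel"
  shows "(\<integral>z. h (f z) \<partial>sgauss) = (\<integral>z. h z \<partial>sgauss)"
proof -
  have [measurable]: "f \<in> borel_measurable borel"
    using orthogonal_transformation_linear [OF f] by (rule borel_measurable_linear)
  have "(\<integral>z. h z \<partial>sgauss) = (\<integral>z. h z \<partial>distr sgauss borel f)"
    by (simp add: distr_sgauss_orthogonal [OF f])
  also have "\<dots> = (\<integral>z. h (f z) \<partial>sgauss)"
    by (rule integral_distr) simp_all
  finally show ?thesis ..
qed

lemma sgauss_basis_square:
  assumes b: "b \<in> Basis"
  shows "integrable sgauss (\<lambda>z. (z \<bullet> b)\<^sup>2)" "(\<integral>z. (z \<bullet> b)\<^sup>2 \<partial>sgauss) = 1"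
proof -
  have "(\<integral>\<^sup>+z. ennreal ((z \<bullet> b)\<^sup>2) \<partial>sgauss)
      = (\<integral>\<^sup>+z. (\<Prod>c\<in>Basis. if c = b then ennreal ((z \<bullet> c)\<^sup>2) else 1) \<partial>sgauss)"
    using b by (simp add: prod.delta)
  also have "\<dots> = (\<Prod>c\<in>(Basis :: 'a set). \<integral>\<^sup>+x. ennreal (std_normal_density x) * (if c = b then ennreal (x\<^sup>2) else 1) \<partial>lborel)"
    by (rule nn_integral_sgauss_prod [of "\<lambda>c x. if c = b then ennreal (x\<^sup>2) else 1"]) auto
  also have "\<dots> = 1"
  proof (intro prod.neutral ballI)
    fix c :: 'a
    show "(\<integral>\<^sup>+x. ennreal (std_normal_density x) * (if c = b then ennreal (x\<^sup>2) else 1) \<partial>lborel) = 1"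
      by (cases "c = b") (simp_all add: nn_integral_std_normal)
  qed
  finally have 1: "(\<integral>\<^sup>+z. ennreal ((z \<bullet> b)\<^sup>2) \<partial>sgauss) = 1" .
  then show "integrable sgauss (\<lambda>z. (z \<bullet> b)\<^sup>2)"
    by (intro integrableI_nonneg) auto
  show "(\<integral>z. (z \<bullet> b)\<^sup>2 \<partial>sgauss) = 1"
    by (subst integral_eq_nn_integral) (simp_all add: 1)
qed

lemma sgauss_basis_mult:
  assumes b: "b \<in> Basis" and c: "c \<in> Basis"
  shows "integrable sgauss (\<lambda>z. (z \<bullet> b) * (z \<bullet> c))"
    "(\<integral>z. (z \<bullet> b) * (z \<bullet> c) \<partial>sgauss) = b \<bullet> c"
proof -
  show "integrable sgauss (\<lambda>z. (z \<bullet> b) * (z \<bullet> c))"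
  proof (rule Bochner_Integration.integrable_bound)
    show "integrable sgauss (\<lambda>z. (z \<bullet> b)\<^sup>2 + (z \<bullet> c)\<^sup>2)"
      by (intro Bochner_Integration.integrable_add sgauss_basis_square b c)
    have "\<bar>x * y\<bar> \<le> x\<^sup>2 + y\<^sup>2" for x y :: real
      using sum_squares_bound [of x y] sum_squares_bound [of "- x" y] by (auto simp: abs_le_iff)
    then show "AE z in sgauss. norm ((z \<bullet> b) * (z \<bullet> c)) \<le> norm ((z \<bullet> b)\<^sup>2 + (z \<bullet> c)\<^sup>2)"
      by simp
  qed measurable
  show "(\<integral>z. (z \<bullet> b) * (z \<bullet> c) \<partial>sgauss) = b \<bullet> c"
  proof (cases "b = c")
    case True
    then show ?thesis using sgauss_basis_square(2) [OF b] b by (simp add: power2_eq_square)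
  next
    case False
    \<comment> \<open>The reflection in the hyperplane orthogonal to \<open>b\<close> flips the sign
      of one coordinate only, so the mixed moment equals its own negative.\<close>
    define f where "f z = z - (2 * (z \<bullet> b)) *\<^sub>R b" for z :: 'a
    have "orthogonal_transformation f"
    proof -
      have "linear f" by (auto simp: linear_iff f_def algebra_simps)
      moreover have "f v \<bullet> f w = v \<bullet> w" for v w
        using b by (simp add: f_def inner_diff_left inner_diff_right algebra_simps inner_commute)
      ultimately show ?thesis by (simp add: orthogonal_transformation_def)
    qed
    then have "(\<integral>z. (f z \<bullet> b) * (f z \<bullet> c) \<partial>sgauss) = (\<integral>z. (z \<bullet> b) * (z \<bullet> c) \<partial>sgauss)"
      by (rule integral_sgauss_orthogonal) measurable
    moreover have "(f z \<bullet> b) * (f z \<bullet> c) = - ((z \<bullet> b) * (z \<bullet> c))" for z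
      using b c False by (simp add: f_def inner_diff_left inner_not_same_Basis)
    ultimately show ?thesis using b c False by (simp add: inner_not_same_Basis)
  qed
qed

lemma sgauss_inner_mult:
  fixes u w :: "'a::euclidean_space"
  shows "integrable sgauss (\<lambda>z. (z \<bullet> u) * (z \<bullet> w))"
    "(\<integral>z. (z \<bullet> u) * (z \<bullet> w) \<partial>sgauss) = u \<bullet> w"
proof -
  have *: "(z \<bullet> u) * (z \<bullet> w) = (\<Sum>b\<in>Basis. \<Sum>c\<in>Basis. (u \<bullet> b) * (w \<bullet> c) * ((z \<bullet> b) * (z \<bullet> c)))" for z
    by (subst euclidean_inner [of z u], subst euclidean_inner [of z w])
      (simp add: sum_product algebra_simps)
  show "integrable sgauss (\<lambda>z. (z \<bullet> u) * (z \<bullet> w))"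
    unfolding * by (intro Bochner_Integration.integrable_sum integrable_mult_right sgauss_basis_mult)
  have "(\<integral>z. (z \<bullet> u) * (z \<bullet> w) \<partial>sgauss) = (\<Sum>b\<in>Basis. \<Sum>c\<in>Basis. (u \<bullet> b) * (w \<bullet> c) * (b \<bullet> c))"
    unfolding * by (simp add: Bochner_Integration.integral_sum integrable_mult_right sgauss_basis_mult)
  also have "\<dots> = (\<Sum>b\<in>Basis. \<Sum>c\<in>Basis. if c = b then (u \<bullet> b) * (w \<bullet> b) else 0)"
    by (intro sum.cong refl) (auto simp: inner_Basis)
  also have "\<dots> = u \<bullet> w"
    by (subst euclidean_inner) simp
  finally show "(\<integral>z. (z \<bullet> u) * (z \<bullet> w) \<partial>sgauss) = u \<bullet> w" .
qed

lemma std_gauss_eq_sgauss: "std_gauss = sgauss"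
proof -
  have eq: "(\<Prod>i\<in>UNIV. std_normal_density (z $ i)) = (\<Prod>b\<in>Basis. std_normal_density (z \<bullet> b))" for z :: "real^'d"
  proof -
    have "(\<Prod>b\<in>(\<lambda>i. axis i 1) ` UNIV. std_normal_density (z \<bullet> b))
        = (\<Prod>i\<in>UNIV. std_normal_density (z \<bullet> axis i 1))"
      by (subst prod.reindex) (auto simp: inj_on_def axis_eq_axis)
    moreover have "(Basis :: (real^'d) set) = (\<lambda>i. axis i 1) ` UNIV"
      by (auto simp: Basis_vec_def)
    ultimately show ?thesis by (simp add: inner_axis)
  qed
  show ?thesis by (simp only: std_gauss_def sgauss_def eq)
qed

text \<open>This makes orthogonal maps that mix the sources of signal and noise available, among
  them the reflection behind \<open>gauss_error_orthogonal\<close>.\<close>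

lemma sgauss_pair: "sgauss \<Otimes>\<^sub>M sgauss = (sgauss :: ('a::euclidean_space \<times> 'b::euclidean_space) measure)"
proof -
  interpret B: prob_space "sgauss :: 'b measure" by (rule prob_space_sgauss)
  have "sgauss \<Otimes>\<^sub>M sgauss = density (lborel \<Otimes>\<^sub>M lborel :: ('a \<times> 'b) measure)
      (\<lambda>(x, y). ennreal (\<Prod>b\<in>Basis. std_normal_density (x \<bullet> b)) * ennreal (\<Prod>b\<in>Basis. std_normal_density (y \<bullet> b)))"
    unfolding sgauss_def
    by (rule pair_measure_density) (auto simp: sigma_finite_lborel B.sigma_finite_measure_axioms simp flip: sgauss_def)
  also have "\<dots> = sgauss"
    unfolding sgauss_def lborel_prod
    by (intro arg_cong [where f = "density lborel"] ext)
      (auto simp: sgauss_density norm_Pair power_add add_divide_distrib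
        simp flip: ennreal_mult exp_add)
  finally show ?thesis .
qed

section \<open>Optimal transport between normal laws\<close>

lemma measurable_matrix_vector_mult [measurable]:
  "(\<lambda>z. A *v z) \<in> borel_measurable borel" for A :: "real^'n^'m"
  by (intro borel_measurable_continuous_onI linear_continuous_on matrix_vector_mul_bounded_linear)

lemma matrix_vector_mult_minus: "(- A) *v x = - (A *v x)" for A :: "real^'n^'m"
  by (simp add: matrix_vector_mult_def vec_eq_iff sum_negf)

lemma prob_space_std_gauss: "prob_space std_gauss"
  unfolding std_gauss_eq_sgauss by (rule prob_space_sgauss)

lemma std_gauss_inner:
  fixes A B :: "real^'d^'k"
  shows "integrable std_gauss (\<lambda>z. (A *v z) \<bullet> (B *v z))"
    "(\<integral>z. (A *v z) \<bullet> (B *v z) \<partial>std_gauss) = A \<bullet> B"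
proof -
  have *: "(A *v z) \<bullet> (B *v z) = (\<Sum>i\<in>UNIV. (z \<bullet> A $ i) * (z \<bullet> B $ i))" for z
    by (simp add: inner_vec_def [of "A *v z"] matrix_vector_mul_component inner_commute)
  show "integrable std_gauss (\<lambda>z. (A *v z) \<bullet> (B *v z))"
    unfolding * std_gauss_eq_sgauss by (intro Bochner_Integration.integrable_sum sgauss_inner_mult)
  show "(\<integral>z. (A *v z) \<bullet> (B *v z) \<partial>std_gauss) = A \<bullet> B"
    unfolding * std_gauss_eq_sgauss
    by (simp add: Bochner_Integration.integral_sum sgauss_inner_mult inner_vec_def [of A])
qed

lemma sets_gauss [simp, measurable_cong]: "sets (gauss mu S) = sets borel"
  by (simp add: gauss_def)

lemma prob_space_gauss: "prob_space (gauss mu S)"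
  unfolding gauss_def std_gauss_eq_sgauss
  by (intro prob_space.prob_space_distr prob_space_sgauss) measurable

text \<open>The freedom to rotate the source lets the optimal coupling drive both marginals with the
  same \<open>Z\<close>.\<close>

lemma gauss_eq_distr_rotated:
  assumes K: "orthogonal_matrix K"
  shows "distr std_gauss borel (\<lambda>z. mu + (msqrt S ** K) *v z) = gauss mu S"
proof -
  have "orthogonal_transformation (\<lambda>z. K *v z)"
    using K by (simp add: orthogonal_transformation_matrix)
  then have "gauss mu S = distr (distr std_gauss borel (\<lambda>z. K *v z)) borel (\<lambda>z. mu + msqrt S *v z)"
    unfolding gauss_def std_gauss_eq_sgauss by (simp add: distr_sgauss_orthogonal)
  also have "\<dots> = distr std_gauss borel ((\<lambda>z. mu + msqrt S *v z) \<circ> (\<lambda>z. K *v z))"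
    unfolding std_gauss_eq_sgauss by (intro distr_distr) measurable
  finally show ?thesis by (simp add: o_def matrix_vector_mul_assoc)
qed

lemma gauss_quadratic_form:
  fixes D :: "real^'d^'d"
  assumes S: "psd_mat S"
  shows "integrable (gauss mu S) (\<lambda>x. (x - mu) \<bullet> (D *v (x - mu)))"
    "(\<integral>x. (x - mu) \<bullet> (D *v (x - mu)) \<partial>gauss mu S) = trace (D ** S)"
proof -
  let ?P = "msqrt S"
  have m [measurable]: "(\<lambda>z. mu + ?P *v z) \<in> measurable std_gauss borel"
    unfolding std_gauss_eq_sgauss by measurable
  have *: "(mu + ?P *v z - mu) \<bullet> (D *v (mu + ?P *v z - mu)) = (?P *v z) \<bullet> ((D ** ?P) *v z)" for z
    by (simp add: matrix_vector_mul_assoc)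
  show "integrable (gauss mu S) (\<lambda>x. (x - mu) \<bullet> (D *v (x - mu)))"
    unfolding gauss_def by (subst integrable_distr_eq [OF m]) (simp_all only: * std_gauss_inner, measurable)
  have "(\<integral>x. (x - mu) \<bullet> (D *v (x - mu)) \<partial>gauss mu S) = ?P \<bullet> (D ** ?P)"
    unfolding gauss_def by (subst integral_distr [OF m]) (simp_all only: * std_gauss_inner, measurable)
  also have "\<dots> = trace (?P ** (D ** ?P))" by (simp add: inner_eq_trace msqrt_transpose [OF S])
  also have "\<dots> = trace (D ** ?P ** ?P)" by (rule trace_mul_sym)
  also have "\<dots> = trace (D ** S)" using msqrt_square [OF S] by (simp flip: matrix_mul_assoc)
  finally show "(\<integral>x. (x - mu) \<bullet> (D *v (x - mu)) \<partial>gauss mu S) = trace (D ** S)" .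
qed

text \<open>The quadratic potentials take both signs while the transport cost is a nonnegative
  integral, possibly infinite; the positive part mediates.\<close>

lemma ennreal_integral_le_nn_integral:
  assumes "integrable M q" "\<And>x. q x \<le> c x" "\<And>x. 0 \<le> c x"
  shows "ennreal (\<integral>x. q x \<partial>M) \<le> (\<integral>\<^sup>+x. ennreal (c x) \<partial>M)"
proof -
  have i: "integrable M (\<lambda>x. max 0 (q x))" using assms(1) by simp
  have "ennreal (\<integral>x. q x \<partial>M) \<le> ennreal (\<integral>x. max 0 (q x) \<partial>M)"
    by (intro ennreal_leI integral_mono assms i) simp
  also have "\<dots> = (\<integral>\<^sup>+x. ennreal (max 0 (q x)) \<partial>M)"
    by (rule nn_integral_eq_integral [OF i, symmetric]) simp
  also have "\<dots> \<le> (\<integral>\<^sup>+x. ennreal (c x) \<partial>M)"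
    by (intro nn_integral_mono ennreal_leI) (simp add: assms)
  finally show ?thesis .
qed

text \<open>Weak Kantorovich duality with quadratic potentials: their sum lies below the cost
  pointwise, and its integral depends on the marginals only. As \<open>T\<close> varies,
  \<open>fidelity_dual_bound\<close> combines these bounds into the Gelbrich distance. The case
  split disposes of infinite cost.\<close>

lemma coupling_cost_ge:
  fixes S S0 :: "real^'d^'d"
  assumes S: "psd_mat S" and S0: "psd_mat S0" and \<pi>: "\<pi> \<in> couplings (gauss mu S) (gauss mu S0)"
  shows "ennreal (gelbrich_sq S S0) \<le> (\<integral>\<^sup>+p. ennreal ((norm (fst p - snd p))\<^sup>2) \<partial>\<pi>)" (is "_ \<le> ?I")
proof (cases ?I)
  case (real I)
  interpret prob_space \<pi> using \<pi> by (simp add: couplings_def)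
  have sets [measurable_cong]: "sets \<pi> = sets borel" using \<pi> by (simp add: couplings_def)
  have d: "distr \<pi> borel fst = gauss mu S" "distr \<pi> borel snd = gauss mu S0"
    using \<pi> by (simp_all add: couplings_def)
  have m [measurable]: "fst \<in> measurable \<pi> borel" "snd \<in> measurable \<pi> borel"
    by (auto simp: measurable_cong_sets [OF sets refl] simp flip: borel_prod)
  have "(trace S + trace S0 - I) / 2 \<le> trace (msqrt (msqrt S0 ** S ** msqrt S0))"
  proof (rule fidelity_dual_bound [OF S S0])
    fix T T' :: "real^'d^'d" assume T: "psd_mat T" "psd_mat T'" "T' ** T = mat 1"
    let ?q = "\<lambda>D x. (x - mu) \<bullet> (D *v (x - mu))"
    \<comment> \<open>Bounding the cross term of the squared norm of \<open>x - y\<close> by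
      \<open>dual_pair_inner_le\<close> leaves these two quadratic forms.\<close>
    let ?D = "mat 1 - T'" and ?E = "mat 1 - T"
    have m1: "(\<lambda>x. ?q D x) \<in> borel_measurable borel" for D :: "real^'d^'d" by measurable
    have q1: "integrable \<pi> (\<lambda>p. ?q ?D (fst p))" "(\<integral>p. ?q ?D (fst p) \<partial>\<pi>) = trace (?D ** S)"
      using gauss_quadratic_form [OF S, of mu ?D] integrable_distr_eq [OF m(1) m1] integral_distr [OF m(1) m1] d
      by simp_all
    have q2: "integrable \<pi> (\<lambda>p. ?q ?E (snd p))" "(\<integral>p. ?q ?E (snd p) \<partial>\<pi>) = trace (?E ** S0)"
      using gauss_quadratic_form [OF S0, of mu ?E] integrable_distr_eq [OF m(2) m1] integral_distr [OF m(2) m1] d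
      by simp_all
    have "ennreal (\<integral>p. ?q ?D (fst p) + ?q ?E (snd p) \<partial>\<pi>) \<le> ?I"
    proof (rule ennreal_integral_le_nn_integral)
      fix p :: "(real^'d) \<times> (real^'d)"
      define x y where "x = fst p - mu" and "y = snd p - mu"
      have "(norm (fst p - snd p))\<^sup>2 = (norm (x - y))\<^sup>2" by (simp add: x_def y_def)
      also have "\<dots> = x \<bullet> x + y \<bullet> y - 2 * (x \<bullet> y)"
        by (simp add: power2_norm_eq_inner algebra_simps inner_commute)
      finally show "?q ?D (fst p) + ?q ?E (snd p) \<le> (norm (fst p - snd p))\<^sup>2"
        using dual_pair_inner_le [OF T, of x y]
        by (simp add: matrix_vector_mult_diff_rdistrib inner_diff_right flip: x_def y_def)
    qed (use q1 q2 in auto)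
    then have "(\<integral>p. ?q ?D (fst p) + ?q ?E (snd p) \<partial>\<pi>) \<le> I"
      using real by simp
    then have "trace (?D ** S) + trace (?E ** S0) \<le> I"
      using q1 q2 by simp
    then show "2 * ((trace S + trace S0 - I) / 2) \<le> trace (T ** S0) + trace (T' ** S)"
      by (simp add: matrix_mult_bilinear_simps trace_sub)
  qed
  then have "gelbrich_sq S S0 \<le> I"
    by (simp add: gelbrich_sq_def trace_add trace_sub trace_scaleR)
  then show ?thesis using real by (simp add: ennreal_leI)
qed simp

lemma coupling_cost_attained:
  fixes S S0 :: "real^'d^'d"
  assumes S: "psd_mat S" and S0: "psd_mat S0"
  obtains \<pi> where "\<pi> \<in> couplings (gauss mu S) (gauss mu S0)"
    "(\<integral>\<^sup>+p. ennreal ((norm (fst p - snd p))\<^sup>2) \<partial>\<pi>) = ennreal (gelbrich_sq S S0)"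
proof -
  obtain K where K: "orthogonal_matrix K"
    "gelbrich_sq S S0 = (norm (msqrt S ** K - msqrt S0))\<^sup>2"
    using gelbrich_sq_attained [OF S S0] by metis
  let ?X = "msqrt S ** K" and ?R = "msqrt S0"
  define f where "f z = (mu + ?X *v z, mu + ?R *v z)" for z
  have [measurable]: "f \<in> measurable std_gauss borel"
    unfolding std_gauss_eq_sgauss f_def by (subst borel_prod [symmetric]) measurable
  define \<pi> where "\<pi> = distr std_gauss borel f"
  have fs: "fst \<in> measurable (borel :: ((real^'d) \<times> (real^'d)) measure) borel"
    "snd \<in> measurable (borel :: ((real^'d) \<times> (real^'d)) measure) borel"
    by (simp_all flip: borel_prod)
  have "prob_space \<pi>"
    unfolding \<pi>_def by (intro prob_space.prob_space_distr) (simp_all add: prob_space_std_gauss)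
  moreover have "distr \<pi> borel fst = gauss mu S"
    unfolding \<pi>_def using gauss_eq_distr_rotated [OF K(1), of mu S]
    by (subst distr_distr [OF fs(1)]) (simp_all add: o_def f_def)
  moreover have "distr \<pi> borel snd = gauss mu S0"
    unfolding \<pi>_def by (subst distr_distr [OF fs(2)]) (simp_all add: o_def f_def gauss_def)
  ultimately have "\<pi> \<in> couplings (gauss mu S) (gauss mu S0)"
    by (simp add: couplings_def \<pi>_def)
  moreover have "(\<integral>\<^sup>+p. ennreal ((norm (fst p - snd p))\<^sup>2) \<partial>\<pi>) = ennreal (gelbrich_sq S S0)"
  proof -
    let ?D = "?X - ?R"
    have cost: "(\<lambda>p :: (real^'d) \<times> (real^'d). (norm (fst p - snd p))\<^sup>2) \<in> borel_measurable borel"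
      by (intro borel_measurable_continuous_onI continuous_intros)
    have "(\<integral>\<^sup>+p. ennreal ((norm (fst p - snd p))\<^sup>2) \<partial>\<pi>)
        = (\<integral>\<^sup>+z. ennreal ((norm (fst (f z) - snd (f z)))\<^sup>2) \<partial>std_gauss)"
      unfolding \<pi>_def
      by (intro nn_integral_distr) (use cost in simp_all)
    also have "\<dots> = (\<integral>\<^sup>+z. ennreal ((?D *v z) \<bullet> (?D *v z)) \<partial>std_gauss)"
      by (simp add: f_def power2_norm_eq_inner matrix_vector_mult_diff_rdistrib)
    also have "\<dots> = ennreal (?D \<bullet> ?D)"
      by (subst nn_integral_eq_integral) (simp_all add: std_gauss_inner)
    finally show ?thesis by (simp add: K(2) power2_norm_eq_inner)
  qed
  ultimately show thesis by (rule that)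
qed

lemma gelbrich_sq_nonneg: "psd_mat S \<Longrightarrow> psd_mat S0 \<Longrightarrow> 0 \<le> gelbrich_sq S S0"
  using gelbrich_sq_attained [of S S0] by (metis zero_le_power2)

lemma wasserstein2_gauss:
  assumes S: "psd_mat S" and S0: "psd_mat S0"
  shows "wasserstein2 (gauss mu S) (gauss mu S0) = sqrt (gelbrich_sq S S0)"
proof -
  obtain \<pi> where \<pi>: "\<pi> \<in> couplings (gauss mu S) (gauss mu S0)"
    "(\<integral>\<^sup>+p. ennreal ((norm (fst p - snd p))\<^sup>2) \<partial>\<pi>) = ennreal (gelbrich_sq S S0)"
    using coupling_cost_attained [OF S S0] by blast
  have "(INF \<pi>\<in>couplings (gauss mu S) (gauss mu S0). \<integral>\<^sup>+p. ennreal ((norm (fst p - snd p))\<^sup>2) \<partial>\<pi>)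
      = ennreal (gelbrich_sq S S0)"
  proof (rule antisym)
    show "\<dots> \<le> (INF \<pi>\<in>couplings (gauss mu S) (gauss mu S0). \<integral>\<^sup>+p. ennreal ((norm (fst p - snd p))\<^sup>2) \<partial>\<pi>)"
      by (intro INF_greatest coupling_cost_ge S S0)
    show "(INF \<pi>\<in>couplings (gauss mu S) (gauss mu S0). \<integral>\<^sup>+p. ennreal ((norm (fst p - snd p))\<^sup>2) \<partial>\<pi>)
        \<le> ennreal (gelbrich_sq S S0)"
      unfolding \<pi>(2) [symmetric] by (rule INF_lower [OF \<pi>(1)])
  qed
  then show ?thesis using gelbrich_sq_nonneg [OF S S0] by (simp add: wasserstein2_def)
qed

lemma wasserstein2_gauss_le_iff:
  assumes "psd_mat S" "psd_mat S0" "0 \<le> r"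
  shows "wasserstein2 (gauss mu S) (gauss mu S0) \<le> r \<longleftrightarrow> gelbrich_sq S S0 \<le> r\<^sup>2"
  using real_sqrt_le_iff [of "gelbrich_sq S S0" "r\<^sup>2"] assms by (simp add: wasserstein2_gauss)

lemma normal_ambiguity_set_eq:
  assumes "psd_mat Sx0" "psd_mat Sw0" "0 \<le> rx" "0 \<le> rw"
  shows "normal_ambiguity_set mux Sx0 muw Sw0 rx rw
    = (\<lambda>(Sx, Sw). gauss mux Sx \<Otimes>\<^sub>M gauss muw Sw) ` feasible Sx0 Sw0 rx rw"
proof -
  have "psd_mat Sx \<and> pd_mat Sw \<and> wasserstein2 (gauss mux Sx) (gauss mux Sx0) \<le> rx \<and>
      wasserstein2 (gauss muw Sw) (gauss muw Sw0) \<le> rw \<longleftrightarrow> (Sx, Sw) \<in> feasible Sx0 Sw0 rx rw" for Sx Sw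
    using assms by (auto simp: feasible_def wasserstein2_gauss_le_iff pd_imp_psd_mat)
  then show ?thesis
    unfolding normal_ambiguity_set_def by (auto simp: image_iff)
qed


section \<open>Optimality of linear estimators for normal laws\<close>

text \<open>The reflection \<open>f\<close> fixes the observation \<open>Y Z\<close> and flips the sign of the linear estimation
  error \<open>e Z\<close>, so \<open>e Z\<close> is uncorrelated with every function of the observation.\<close>

lemma gauss_error_orthogonal:
  fixes H :: "real^'n^'m" and P :: "real^'n^'n" and B :: "real^'m^'m" and A :: "real^'m^'n"
    and \<phi> :: "real^'m \<Rightarrow> real^'n"
  assumes P: "transpose P = P" and B: "transpose B = B"
    and G: "pd_mat (H ** (P ** P) ** transpose H + B ** B)"
    and A: "A ** (H ** (P ** P) ** transpose H + B ** B) = P ** P ** transpose H"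
    and [measurable]: "\<phi> \<in> borel_measurable borel"
  defines "Y \<equiv> \<lambda>Z. (H ** P) *v fst Z + B *v snd Z"
  defines "e \<equiv> \<lambda>Z. P *v fst Z - A *v Y Z"
  shows "(\<integral>Z. e Z \<bullet> \<phi> (Y Z) \<partial>sgauss) = 0"
proof -
  define G where "G = H ** (P ** P) ** transpose H + B ** B"
  \<comment> \<open>\<open>YT\<close> is the adjoint of \<open>Y\<close>, and \<open>G\<close>
    represents \<open>Y\<close> after \<open>YT\<close>.\<close>
  define YT where "YT u = ((P ** transpose H) *v u, B *v u)" for u
  have YYT: "Y (YT u) = G *v u" for u
    by (simp add: Y_def YT_def G_def matrix_vector_mul_assoc matrix_vector_mult_add_rdistrib matrix_mul_assoc)
  have adj: "YT u \<bullet> Z = u \<bullet> Y Z" for u Z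
    by (cases Z) (simp add: YT_def Y_def inner_add_right inner_transpose [of u] matrix_transpose_mul P B)
  have linY: "linear Y" and linYT: "linear YT"
    by (auto simp: linear_iff Y_def YT_def algebra_simps)
  define g where "g Z = matrix_inv G *v Y Z" for Z
  have Gg: "G *v g Z = Y Z" for Z
    using pd_mat_inv(1) [OF \<open>pd_mat _\<close>] by (simp add: g_def matrix_vector_mul_assoc G_def)
  have ling: "linear g"
    unfolding g_def using linear_compose [OF linY matrix_vector_mul_linear, of "matrix_inv G"] by (simp add: o_def)
  \<comment> \<open>\<open>YT (g Z)\<close> is the orthogonal projection of \<open>Z\<close> onto
    the range of \<open>YT\<close>, the orthogonal complement of the kernel of \<open>Y\<close>. So
    \<open>f\<close> is the identity there and minus the identity on the kernel.\<close>
  define f where "f Z = 2 *\<^sub>R YT (g Z) - Z" for Z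
  have "linear f"
    using linear_compose [OF ling linYT]
    by (auto simp: linear_iff f_def algebra_simps o_def)
  moreover have "norm (f Z) = norm Z" for Z
  proof -
    have "f Z \<bullet> f Z = 4 * (YT (g Z) \<bullet> YT (g Z)) - 4 * (YT (g Z) \<bullet> Z) + Z \<bullet> Z"
      by (simp add: f_def inner_diff_left inner_diff_right inner_commute algebra_simps)
    also have "YT (g Z) \<bullet> YT (g Z) = YT (g Z) \<bullet> Z"
      by (simp add: adj YYT Gg)
    finally show ?thesis by (simp add: norm_eq_sqrt_inner)
  qed
  ultimately have f: "orthogonal_transformation f" by (simp add: orthogonal_transformation)
  have Yf: "Y (f Z) = Y Z" for Z
  proof -
    have "Y (f Z) = 2 *\<^sub>R Y (YT (g Z)) - Y Z"
      by (simp only: f_def linear_diff [OF linY] linear_scale [OF linY])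
    then show ?thesis by (simp add: YYT Gg scaleR_2)
  qed
  \<comment> \<open>The normal equation for \<open>A\<close> makes the error vanish on the range of
    the adjoint, so \<open>e\<close> only sees the component that \<open>f\<close> negates.\<close>
  have "e (YT u) = 0" for u
  proof -
    have "A *v (G *v u) = (P ** P ** transpose H) *v u"
      using A by (simp add: matrix_vector_mul_assoc G_def)
    then show ?thesis
      by (simp add: e_def YYT) (simp add: YT_def matrix_vector_mul_assoc matrix_mul_assoc)
  qed
  moreover have "linear e"
    using linY by (auto simp: linear_iff e_def algebra_simps)
  ultimately have ef: "e (f Z) = - e Z" for Z
    by (simp add: f_def linear_diff linear_scale)
  have [measurable]: "Y \<in> borel_measurable borel" "e \<in> borel_measurable borel"
    by (intro borel_measurable_linear linY \<open>linear e\<close>)+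
  have "(\<integral>Z. e (f Z) \<bullet> \<phi> (Y (f Z)) \<partial>sgauss) = (\<integral>Z. e Z \<bullet> \<phi> (Y Z) \<partial>sgauss)"
    by (rule integral_sgauss_orthogonal [OF f, of "\<lambda>Z. e Z \<bullet> \<phi> (Y Z)"]) measurable
  then show ?thesis by (simp add: ef Yf)
qed

lemma sgauss_linear_pair_norm:
  fixes U :: "real^'n^'k" and W :: "real^'m^'k"
  shows "integrable sgauss (\<lambda>Z. (norm (U *v fst Z + W *v snd Z))\<^sup>2)"
    "(\<integral>Z. (norm (U *v fst Z + W *v snd Z))\<^sup>2 \<partial>sgauss) = (norm U)\<^sup>2 + (norm W)\<^sup>2"
proof -
  have *: "(norm (U *v fst Z + W *v snd Z))\<^sup>2 = (\<Sum>i\<in>UNIV. (Z \<bullet> (U $ i, W $ i)) * (Z \<bullet> (U $ i, W $ i)))" for Z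
    by (cases Z) (simp add: power2_norm_eq_inner inner_vec_def [of "_ + _"] matrix_vector_mul_component inner_commute)
  show "integrable sgauss (\<lambda>Z. (norm (U *v fst Z + W *v snd Z))\<^sup>2)"
    unfolding * by (intro Bochner_Integration.integrable_sum sgauss_inner_mult)
  have "(\<integral>Z. (norm (U *v fst Z + W *v snd Z))\<^sup>2 \<partial>sgauss) = (\<Sum>i\<in>UNIV. U $ i \<bullet> U $ i + W $ i \<bullet> W $ i)"
    unfolding * by (simp add: Bochner_Integration.integral_sum sgauss_inner_mult)
  then show "(\<integral>Z. (norm (U *v fst Z + W *v snd Z))\<^sup>2 \<partial>sgauss) = (norm U)\<^sup>2 + (norm W)\<^sup>2"
    by (simp add: power2_norm_eq_inner inner_vec_def [of U] inner_vec_def [of W] sum.distrib)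
qed

text \<open>Pythagoras: \<open>\<phi>\<close> is the deviation of \<open>\<psi>\<close> from the
  linear estimator as a function of the centred observation. The error is the linear error plus
  \<open>\<phi>\<close> of the observation, and the cross term vanishes by
  \<open>gauss_error_orthogonal\<close>.\<close>

lemma mse_gauss_eq:
  fixes H :: "real^'n^'m" and mux :: "real^'n" and muw :: "real^'m"
  assumes \<psi>: "\<psi> \<in> estimators" and Sx: "psd_mat Sx" and Sw: "pd_mat Sw"
  defines "ybar \<equiv> H *v mux + muw"
  defines "\<phi> \<equiv> \<lambda>u. mux + gain H Sx Sw *v u - \<psi> (ybar + u)"
  shows "mse H \<psi> (gauss mux Sx \<Otimes>\<^sub>M gauss muw Sw) = mmse_obj H Sx Sw
    + (\<integral>Z. (norm (\<phi> ((H ** msqrt Sx) *v fst Z + msqrt Sw *v snd Z)))\<^sup>2 \<partial>sgauss)"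
proof -
  define P where "P = msqrt Sx"
  define B where "B = msqrt Sw"
  define A where "A = gain H Sx Sw"
  have P: "P ** P = Sx" "transpose P = P" using msqrt [OF Sx] by (simp_all add: P_def)
  have B: "B ** B = Sw" "transpose B = B" using msqrt [OF pd_imp_psd_mat [OF Sw]] by (simp_all add: B_def)
  define Y where "Y Z = (H ** P) *v fst Z + B *v snd Z" for Z :: "(real^'n) \<times> (real^'m)"
  define e where "e Z = P *v fst Z - A *v Y Z" for Z
  have e: "e Z = (P - A ** H ** P) *v fst Z + (- (A ** B)) *v snd Z" for Z
    by (simp add: e_def Y_def algebra_simps matrix_vector_mult_minus matrix_vector_mul_assoc matrix_mul_assoc)
  from \<psi> obtain C where [measurable]: "\<psi> \<in> borel_measurable borel"
    and C: "C > 0" "\<And>y. norm (\<psi> y) \<le> C * (1 + norm y)"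
    by (auto simp: estimators_def)
  have [measurable]: "\<phi> \<in> borel_measurable borel"
    unfolding \<phi>_def by measurable
  have "linear Y" by (auto simp: linear_iff Y_def algebra_simps)
  moreover from this have "linear e" by (auto simp: linear_iff e_def algebra_simps)
  ultimately have [measurable]: "Y \<in> borel_measurable borel" "e \<in> borel_measurable borel"
    by (auto intro: borel_measurable_linear)
  let ?M = "sgauss :: ((real^'n) \<times> (real^'m)) measure"
  interpret prob_space ?M by (rule prob_space_sgauss)
  have ie: "integrable ?M (\<lambda>Z. (norm (e Z))\<^sup>2)"
    unfolding e by (rule sgauss_linear_pair_norm)
  have Ee: "(\<integral>Z. (norm (e Z))\<^sup>2 \<partial>?M) = mmse_obj H Sx Sw"
  proof -
    have "(\<integral>Z. (norm (e Z))\<^sup>2 \<partial>?M) = (norm (P - A ** H ** P))\<^sup>2 + (norm (A ** B))\<^sup>2"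
      unfolding e by (subst sgauss_linear_pair_norm) simp
    also have "P - A ** H ** P = (mat 1 - A ** H) ** P"
      by (simp add: matrix_mult_bilinear_simps)
    also have "(norm ((mat 1 - A ** H) ** P))\<^sup>2 + (norm (A ** B))\<^sup>2 = linear_mse H A Sx Sw"
      unfolding norm_eq_trace linear_mse_def
      by (simp add: matrix_transpose_mul P B trace_add matrix_mul_assoc flip: P(1) B(1))
    finally show ?thesis by (simp add: A_def linear_mse_gain Sx Sw)
  qed
  have iY: "integrable ?M (\<lambda>Z. (norm (Y Z))\<^sup>2)"
    unfolding Y_def by (rule sgauss_linear_pair_norm)
  \<comment> \<open>Linear growth of \<open>\<psi>\<close> enters here. The Bochner integral of a
    function that is not integrable is 0, so the square may be split only once each term is known to
    be integrable.\<close>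
  have i\<phi>: "integrable ?M (\<lambda>Z. (norm (\<phi> (Y Z)))\<^sup>2)"
  proof -
    obtain K where K: "K > 0" "\<And>u. norm (A *v u) \<le> norm u * K"
      using bounded_linear.pos_bounded [OF matrix_vector_mul_bounded_linear, of A] by blast
    define a where "a = norm mux + C * (1 + norm ybar)"
    have "(norm (\<phi> u))\<^sup>2 \<le> 2 * a\<^sup>2 + 2 * (K + C)\<^sup>2 * (norm u)\<^sup>2" for u
    proof -
      have "norm (\<phi> u) \<le> norm mux + norm (A *v u) + norm (\<psi> (ybar + u))"
        unfolding \<phi>_def A_def [symmetric]
        by (rule order_trans [OF norm_triangle_ineq4 add_right_mono [OF norm_triangle_ineq]])
      also have "\<dots> \<le> norm mux + norm u * K + C * (1 + (norm ybar + norm u))"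
        using C by (intro add_mono order_refl K order_trans [OF C(2)] mult_left_mono)
          (auto simp: norm_triangle_ineq)
      also have "\<dots> = a + (K + C) * norm u" by (simp add: a_def algebra_simps)
      finally have "(norm (\<phi> u))\<^sup>2 \<le> (a + (K + C) * norm u)\<^sup>2" by (simp add: power_mono)
      also have "\<dots> \<le> 2 * a\<^sup>2 + 2 * ((K + C) * norm u)\<^sup>2"
        using sum_squares_bound [of a "(K + C) * norm u"] by (simp add: power2_sum)
      finally show ?thesis by (simp add: power_mult_distrib)
    qed
    then show ?thesis
      by (intro Bochner_Integration.integrable_bound [OF Bochner_Integration.integrable_add
            [OF integrable_const [of "2 * a\<^sup>2"] integrable_mult_right [OF iY, of "2 * (K + C)\<^sup>2"]]])
        (auto intro: order_trans [OF _ abs_ge_self])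
  qed
  have ie\<phi>: "integrable ?M (\<lambda>Z. e Z \<bullet> \<phi> (Y Z))"
  proof (rule Bochner_Integration.integrable_bound [OF Bochner_Integration.integrable_add [OF ie i\<phi>]])
    have "\<bar>x \<bullet> y\<bar> \<le> (norm x)\<^sup>2 + (norm y)\<^sup>2" for x y :: "real^'n"
      using Cauchy_Schwarz_ineq2 [of x y] sum_squares_bound [of "norm x" "norm y"]
        mult_nonneg_nonneg [OF norm_ge_zero [of x] norm_ge_zero [of y]] by linarith
    then show "AE Z in ?M. norm (e Z \<bullet> \<phi> (Y Z)) \<le> norm ((norm (e Z))\<^sup>2 + (norm (\<phi> (Y Z)))\<^sup>2)"
      by simp
  qed measurable
  have orth: "(\<integral>Z. e Z \<bullet> \<phi> (Y Z) \<partial>?M) = 0"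
    unfolding e_def Y_def
  proof (rule gauss_error_orthogonal [OF P(2) B(2)])
    have G: "pd_mat (H ** Sx ** transpose H + Sw)" using Sx Sw by (rule pd_mat_observation)
    then show "pd_mat (H ** (P ** P) ** transpose H + B ** B)" by (simp add: P B)
    show "A ** (H ** (P ** P) ** transpose H + B ** B) = P ** P ** transpose H"
      using pd_mat_inv(2) [OF G] by (simp add: P B A_def gain_def flip: matrix_mul_assoc)
  qed measurable
  have law: "gauss mux Sx \<Otimes>\<^sub>M gauss muw Sw
      = distr ?M (borel \<Otimes>\<^sub>M borel) (\<lambda>(z, z'). (mux + P *v z, muw + B *v z'))"
    unfolding gauss_def P_def B_def std_gauss_eq_sgauss sgauss_pair [symmetric]
  proof (rule pair_measure_distr)
    show "sigma_finite_measure (distr sgauss borel (\<lambda>z. muw + msqrt Sw *v z))"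
      using prob_space_gauss [of muw Sw] unfolding gauss_def std_gauss_eq_sgauss
      by (simp add: prob_space_imp_sigma_finite)
  qed measurable
  have "mse H \<psi> (gauss mux Sx \<Otimes>\<^sub>M gauss muw Sw)
      = (\<integral>Z. (norm (mux + P *v fst Z - \<psi> (H *v (mux + P *v fst Z) + (muw + B *v snd Z))))\<^sup>2 \<partial>?M)"
    unfolding mse_def law sgauss_pair [symmetric]
    by (subst integral_distr) (simp_all add: case_prod_beta)
  also have "\<dots> = (\<integral>Z. (norm (e Z))\<^sup>2 + (2 * (e Z \<bullet> \<phi> (Y Z)) + (norm (\<phi> (Y Z)))\<^sup>2) \<partial>?M)"
  proof (rule Bochner_Integration.integral_cong [OF refl])
    fix Z :: "(real^'n) \<times> (real^'m)"
    have "H *v (mux + P *v fst Z) + (muw + B *v snd Z) = ybar + Y Z"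
      by (simp add: ybar_def Y_def algebra_simps matrix_vector_mul_assoc)
    then have eq: "mux + P *v fst Z - \<psi> (H *v (mux + P *v fst Z) + (muw + B *v snd Z)) = e Z + \<phi> (Y Z)"
      by (simp add: \<phi>_def e_def A_def)
    show "(norm (mux + P *v fst Z - \<psi> (H *v (mux + P *v fst Z) + (muw + B *v snd Z))))\<^sup>2
        = (norm (e Z))\<^sup>2 + (2 * (e Z \<bullet> \<phi> (Y Z)) + (norm (\<phi> (Y Z)))\<^sup>2)"
      unfolding eq by (simp add: power2_norm_eq_inner inner_add_left inner_add_right inner_commute)
  qed
  also have "\<dots> = mmse_obj H Sx Sw + (\<integral>Z. (norm (\<phi> (Y Z)))\<^sup>2 \<partial>?M)"
    using ie i\<phi> ie\<phi> by (simp add: Ee orth)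
  finally show ?thesis by (simp add: Y_def P_def B_def)
qed

lemma INF_mse_gauss:
  fixes H :: "real^'n^'m"
  assumes Sx: "psd_mat Sx" and Sw: "pd_mat Sw"
  shows "(INF \<psi>\<in>estimators. ereal (mse H \<psi> (gauss mux Sx \<Otimes>\<^sub>M gauss muw Sw))) = ereal (mmse_obj H Sx Sw)"
proof (rule antisym)
  define ybar where "ybar = H *v mux + muw"
  define A where "A = gain H Sx Sw"
  \<comment> \<open>The affine estimator for which the function \<open>\<phi>\<close> of
    \<open>mse_gauss_eq\<close> vanishes identically.\<close>
  define \<psi> where "\<psi> y = mux + A *v (y - ybar)" for y
  have est: "\<psi> \<in> estimators"
  proof -
    have "\<psi> \<in> borel_measurable borel" unfolding \<psi>_def by measurable
    moreover obtain K where K: "K > 0" "\<And>u. norm (A *v u) \<le> norm u * K"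
      using bounded_linear.pos_bounded [OF matrix_vector_mul_bounded_linear, of A] by blast
    have "norm (\<psi> y) \<le> (norm mux + norm ybar * K + K) * (1 + norm y)" for y
    proof -
      have "norm (\<psi> y) \<le> norm mux + norm (A *v (y - ybar))"
        unfolding \<psi>_def by (rule norm_triangle_ineq)
      also have "\<dots> \<le> norm mux + (norm y + norm ybar) * K"
        using K(1) by (intro add_left_mono order_trans [OF K(2)] mult_right_mono norm_triangle_ineq4) auto
      also have "\<dots> \<le> (norm mux + norm ybar * K + K) * (1 + norm y)"
        using K(1) by (simp add: algebra_simps)
      finally show ?thesis .
    qed
    moreover have "0 < norm mux + norm ybar * K + K"
      using K(1) by (simp add: add_nonneg_pos)
    ultimately show ?thesis unfolding estimators_def by blast
  qed
  have "mse H \<psi> (gauss mux Sx \<Otimes>\<^sub>M gauss muw Sw) = mmse_obj H Sx Sw"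
    unfolding mse_gauss_eq [OF est Sx Sw] by (simp add: \<psi>_def ybar_def A_def)
  then show "(INF \<psi>\<in>estimators. ereal (mse H \<psi> (gauss mux Sx \<Otimes>\<^sub>M gauss muw Sw))) \<le> ereal (mmse_obj H Sx Sw)"
    using INF_lower [OF est, of "\<lambda>\<psi>. ereal (mse H \<psi> (gauss mux Sx \<Otimes>\<^sub>M gauss muw Sw))"] by simp
  show "ereal (mmse_obj H Sx Sw) \<le> (INF \<psi>\<in>estimators. ereal (mse H \<psi> (gauss mux Sx \<Otimes>\<^sub>M gauss muw Sw)))"
    by (rule INF_greatest) (simp add: mse_gauss_eq Sx Sw)
qed

section \<open>Existence of a maximizer\<close>

lemma closed_loewner_ge_mult_transpose:
  "closed {X :: real^'k^'k. loewner_ge (X ** transpose X) T}"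
  using closed_vimage [OF closed_psd_mat, of "\<lambda>X. X ** transpose X - T"]
  by (simp add: loewner_ge_def vimage_def continuous_intros)

lemma mmse_obj_maximizer:
  fixes H :: "real^'n^'m"
  assumes Sx0: "psd_mat Sx0" and Sw0: "pd_mat Sw0" and r: "0 \<le> rx" "0 \<le> rw"
  obtains Sx Sw where "(Sx, Sw) \<in> feasible Sx0 Sw0 rx rw"
    "\<And>Sx' Sw'. (Sx', Sw') \<in> feasible Sx0 Sw0 rx rw \<Longrightarrow> mmse_obj H Sx' Sw' \<le> mmse_obj H Sx Sw"
    "loewner_ge Sx (lambda_min Sx0 *\<^sub>R mat 1)" "loewner_ge Sw (lambda_min Sw0 *\<^sub>R mat 1)"
proof -
  note Sw0' = pd_imp_psd_mat [OF Sw0]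
  let ?lx = "lambda_min Sx0" and ?lw = "lambda_min Sw0"
  have lw: "0 < ?lw" using Sw0' Sw0 by (rule lambda_min_pos)
  \<comment> \<open>A positive lower bound on the noise covariance turns definiteness into a closed
    condition, so limits stay feasible.\<close>
  have pd: "pd_mat S" if "loewner_ge S (?lw *\<^sub>R mat 1)" for S :: "real^'m^'m"
    using pd_mat_add [OF that [unfolded loewner_ge_def] pd_mat_scaled_identity [OF lw]] by simp
  let ?f = "\<lambda>(X, Y). mmse_obj H (X ** transpose X) (Y ** transpose Y)"
  define C where "C = (cball (msqrt Sx0) rx \<inter> {X. loewner_ge (X ** transpose X) (?lx *\<^sub>R mat 1)})
    \<times> (cball (msqrt Sw0) rw \<inter> {Y. loewner_ge (Y ** transpose Y) (?lw *\<^sub>R mat 1)})"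
  have comp: "compact C"
    unfolding C_def by (intro compact_Times compact_Int_closed compact_cball closed_loewner_ge_mult_transpose)
  have feas: "(X ** transpose X, Y ** transpose Y) \<in> feasible Sx0 Sw0 rx rw" if "(X, Y) \<in> C" for X Y
  proof -
    have "norm (X - msqrt Sx0) \<le> rx" "norm (Y - msqrt Sw0) \<le> rw"
      using that by (auto simp: C_def dist_norm norm_minus_commute)
    then have "(norm (X - msqrt Sx0))\<^sup>2 \<le> rx\<^sup>2" "(norm (Y - msqrt Sw0))\<^sup>2 \<le> rw\<^sup>2"
      by (simp_all add: power_mono)
    then show ?thesis
      using gelbrich_sq_le_norm [OF Sx0, of X] gelbrich_sq_le_norm [OF Sw0', of Y] that pd
      by (auto simp: feasible_def psd_mat_mult_transpose C_def)
  qed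
  \<comment> \<open>\<open>C\<close> need not represent every feasible pair: raising both
    covariances above their \<open>lambda_min\<close> bounds does not lower the objective, so the
    supremum over \<open>C\<close> bounds all feasible values.\<close>
  have dom: "\<exists>p\<in>C. mmse_obj H Sx Sw \<le> ?f p" if S: "(Sx, Sw) \<in> feasible Sx0 Sw0 rx rw" for Sx Sw
  proof -
    have Sx: "psd_mat Sx" "gelbrich_sq Sx Sx0 \<le> rx\<^sup>2" and Sw: "pd_mat Sw" "gelbrich_sq Sw Sw0 \<le> rw\<^sup>2"
      using S by (auto simp: feasible_def)
    obtain Sx' where x: "psd_mat Sx'" "loewner_ge Sx' Sx" "loewner_ge Sx' (?lx *\<^sub>R mat 1)"
      "gelbrich_sq Sx' Sx0 \<le> rx\<^sup>2"
      by (rule gelbrich_ball_dominated [OF Sx(1) Sx0 lambda_min_nonneg [OF Sx0]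
            loewner_ge_lambda_min [OF Sx0] Sx(2) r(1)])
    obtain Sw' where w: "psd_mat Sw'" "loewner_ge Sw' Sw" "loewner_ge Sw' (?lw *\<^sub>R mat 1)"
      "gelbrich_sq Sw' Sw0 \<le> rw\<^sup>2"
      by (rule gelbrich_ball_dominated [OF pd_imp_psd_mat [OF Sw(1)] Sw0' lambda_min_nonneg [OF Sw0']
            loewner_ge_lambda_min [OF Sw0'] Sw(2) r(2)])
    obtain K where K: "gelbrich_sq Sx' Sx0 = (norm (msqrt Sx' ** K - msqrt Sx0))\<^sup>2"
      "(msqrt Sx' ** K) ** transpose (msqrt Sx' ** K) = Sx'"
      by (rule gelbrich_sq_attained [OF x(1) Sx0])
    obtain L where L: "gelbrich_sq Sw' Sw0 = (norm (msqrt Sw' ** L - msqrt Sw0))\<^sup>2"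
      "(msqrt Sw' ** L) ** transpose (msqrt Sw' ** L) = Sw'"
      by (rule gelbrich_sq_attained [OF w(1) Sw0'])
    have "norm (msqrt Sx' ** K - msqrt Sx0) \<le> rx"
      using x(4) r(1) unfolding K(1) by (rule power2_le_imp_le)
    moreover have "norm (msqrt Sw' ** L - msqrt Sw0) \<le> rw"
      using w(4) r(2) unfolding L(1) by (rule power2_le_imp_le)
    ultimately have "(msqrt Sx' ** K, msqrt Sw' ** L) \<in> C"
      unfolding C_def using x(3) w(3) K(2) L(2) by (simp add: dist_norm norm_minus_commute)
    moreover have "mmse_obj H Sx Sw \<le> ?f (msqrt Sx' ** K, msqrt Sw' ** L)"
      using mmse_obj_mono [OF Sx(1) Sw(1) x(1) pd [OF w(3)] x(2) w(2)] K(2) L(2) by simp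
    ultimately show ?thesis by blast
  qed
  have "(msqrt Sx0, msqrt Sw0) \<in> C"
    using loewner_ge_lambda_min [OF Sx0] loewner_ge_lambda_min [OF Sw0'] r
    by (simp add: C_def msqrt [OF Sx0] msqrt [OF Sw0'])
  then have ne: "C \<noteq> {}" by blast
  have bdd: "bdd_above (?f ` C)"
  proof -
    obtain b where b: "\<And>p. p \<in> C \<Longrightarrow> norm p \<le> b"
      using compact_imp_bounded [OF comp] by (auto simp: bounded_iff)
    have "?f p \<le> b\<^sup>2" if p: "p \<in> C" for p
    proof -
      obtain X Y where XY: "p = (X, Y)" by (cases p)
      \<comment> \<open>Zero gain, that is a constant estimator, bounds the objective by the trace
        of the signal covariance.\<close>
      have "?f p \<le> linear_mse H 0 (X ** transpose X) (Y ** transpose Y)"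
        using feas [of X Y] p XY by (auto simp: feasible_def intro!: mmse_obj_le_linear_mse)
      also have "\<dots> = (norm X)\<^sup>2"
        by (simp add: linear_mse_def matrix_mult_bilinear_simps norm_eq_trace)
      also have "\<dots> \<le> b\<^sup>2"
        using b [OF p] norm_fst_le [of X Y] XY by (intro power_mono) auto
      finally show ?thesis .
    qed
    then show ?thesis by (rule bdd_aboveI2)
  qed
  define s where "s = (SUP p\<in>C. ?f p)"
  have "\<exists>p\<in>C. s - inverse (real (Suc k)) < ?f p" for k
  proof -
    have "s - inverse (real (Suc k)) < (SUP p\<in>C. ?f p)" by (simp add: s_def)
    then show ?thesis by (subst (asm) less_cSUP_iff [OF ne bdd])
  qed
  then have "\<forall>k. \<exists>p. p \<in> C \<and> s - inverse (real (Suc k)) < ?f p" by blast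
  from choice [OF this] obtain p where "\<forall>k. p k \<in> C \<and> s - inverse (real (Suc k)) < ?f (p k)" ..
  then have p: "p k \<in> C" "s - inverse (real (Suc k)) < ?f (p k)" for k by blast+
  obtain q \<sigma> where q: "q \<in> C" and \<sigma>: "strict_mono \<sigma>" and lim: "(p \<circ> \<sigma>) \<longlonglongrightarrow> q"
    using comp [unfolded compact_def, rule_format, of p] p(1) by auto
  obtain X Y where XY: "q = (X, Y)" by (cases q)
  let ?Sx = "X ** transpose X" and ?Sw = "Y ** transpose Y"
  have qf: "(?Sx, ?Sw) \<in> feasible Sx0 Sw0 rx rw" using feas q XY by simp
  have s_le: "s \<le> mmse_obj H ?Sx ?Sw"
  proof -
    \<comment> \<open>The gain is frozen at the limit: \<open>?L\<close> is continuous, dominates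
      the objective along the sequence and agrees with it at \<open>q\<close>.\<close>
    define A where "A = gain H ?Sx ?Sw"
    let ?L = "\<lambda>p. linear_mse H A (fst p ** transpose (fst p)) (snd p ** transpose (snd p))"
    have "s - 0 \<le> ?L q"
    proof (rule LIMSEQ_le)
      show "(\<lambda>k. s - inverse (real (Suc (\<sigma> k)))) \<longlonglongrightarrow> s - 0"
        using LIMSEQ_subseq_LIMSEQ [OF LIMSEQ_inverse_real_of_nat \<sigma>]
        by (intro tendsto_intros) (simp add: o_def)
      show "(\<lambda>k. ?L (p (\<sigma> k))) \<longlonglongrightarrow> ?L q"
        unfolding linear_mse_def using lim
        by (intro tendsto_intros tendsto_trace tendsto_matrix_mult tendsto_transpose) (simp_all add: o_def)
      have "s - inverse (real (Suc (\<sigma> k))) \<le> ?L (p (\<sigma> k))" for k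
      proof -
        obtain U W where UW: "p (\<sigma> k) = (U, W)" by (cases "p (\<sigma> k)")
        have "?f (p (\<sigma> k)) \<le> ?L (p (\<sigma> k))"
          using feas [of U W] p(1) [of "\<sigma> k"] UW by (auto simp: feasible_def intro!: mmse_obj_le_linear_mse)
        then show ?thesis using p(2) [of "\<sigma> k"] by linarith
      qed
      then show "\<exists>N. \<forall>k\<ge>N. s - inverse (real (Suc (\<sigma> k))) \<le> ?L (p (\<sigma> k))" by blast
    qed
    also have "?L q = mmse_obj H ?Sx ?Sw"
      using qf by (simp add: XY A_def linear_mse_gain feasible_def)
    finally show ?thesis by simp
  qed
  have "mmse_obj H Sx' Sw' \<le> s" if S: "(Sx', Sw') \<in> feasible Sx0 Sw0 rx rw" for Sx' Sw'
  proof -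
    obtain p where "p \<in> C" "mmse_obj H Sx' Sw' \<le> ?f p" using dom [OF S] by blast
    then show ?thesis unfolding s_def by (intro cSUP_upper2 [OF bdd])
  qed
  from order_trans [OF this s_le] show thesis
    using q XY by (intro that [OF qf]) (simp_all add: C_def)
qed

theorem mainTheorem7:
  fixes H :: "real^'n^'m"
    and mux :: "real^'n" and Sx0 :: "real^'n^'n"
    and muw :: "real^'m" and Sw0 :: "real^'m^'m"
    and rx rw :: real
  assumes "psd_mat Sx0" and "psd_mat Sw0" and "0 \<le> rx" and "0 \<le> rw"
  shows "(SUP Q\<in>normal_ambiguity_set mux Sx0 muw Sw0 rx rw.
            (INF \<psi>\<in>estimators. ereal (mse H \<psi> Q)))
         = (SUP S\<in>feasible Sx0 Sw0 rx rw. ereal (mmse_obj H (fst S) (snd S)))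
       \<and> (pd_mat Sw0 \<longrightarrow>
           (\<exists>Sx Sw. (Sx, Sw) \<in> feasible Sx0 Sw0 rx rw \<and>
              ereal (mmse_obj H Sx Sw) = (SUP S\<in>feasible Sx0 Sw0 rx rw. ereal (mmse_obj H (fst S) (snd S))) \<and>
              loewner_ge Sx (lambda_min Sx0 *\<^sub>R mat 1) \<and>
              loewner_ge Sw (lambda_min Sw0 *\<^sub>R mat 1))
         \<and> (\<forall>Sx Sw. (Sx, Sw) \<in> feasible Sx0 Sw0 rx rw \<and>
              ereal (mmse_obj H Sx Sw) = (SUP S\<in>feasible Sx0 Sw0 rx rw. ereal (mmse_obj H (fst S) (snd S)))
              \<longrightarrow> gauss mux Sx \<Otimes>\<^sub>M gauss muw Sw \<in> normal_ambiguity_set mux Sx0 muw Sw0 rx rw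
                \<and> (INF \<psi>\<in>estimators. ereal (mse H \<psi> (gauss mux Sx \<Otimes>\<^sub>M gauss muw Sw)))
                  = (SUP Q\<in>normal_ambiguity_set mux Sx0 muw Sw0 rx rw.
                      (INF \<psi>\<in>estimators. ereal (mse H \<psi> Q)))))"
proof -
  have INF_eq: "(INF \<psi>\<in>estimators. ereal (mse H \<psi> (gauss mux Sx \<Otimes>\<^sub>M gauss muw Sw))) = ereal (mmse_obj H Sx Sw)"
    if "(Sx, Sw) \<in> feasible Sx0 Sw0 rx rw" for Sx Sw
    using that by (intro INF_mse_gauss) (auto simp: feasible_def)
  \<comment> \<open>Indexed by covariances, both suprema agree term by term, whether or not they are
    attained. For singular \<open>Sw0\<close> and \<open>rw = 0\<close> the feasible set is empty
    and both sides are the least element of \<open>ereal\<close>.\<close>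
  have eq: "(SUP Q\<in>normal_ambiguity_set mux Sx0 muw Sw0 rx rw. (INF \<psi>\<in>estimators. ereal (mse H \<psi> Q)))
      = (SUP S\<in>feasible Sx0 Sw0 rx rw. ereal (mmse_obj H (fst S) (snd S)))"
    unfolding normal_ambiguity_set_eq [OF assms] image_image
    by (rule SUP_cong) (auto simp: INF_eq)
  have solvable: "\<exists>Sx Sw. (Sx, Sw) \<in> feasible Sx0 Sw0 rx rw \<and>
      ereal (mmse_obj H Sx Sw) = (SUP S\<in>feasible Sx0 Sw0 rx rw. ereal (mmse_obj H (fst S) (snd S))) \<and>
      loewner_ge Sx (lambda_min Sx0 *\<^sub>R mat 1) \<and> loewner_ge Sw (lambda_min Sw0 *\<^sub>R mat 1)"
    if Sw0: "pd_mat Sw0"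
  proof -
    obtain Sx Sw where S: "(Sx, Sw) \<in> feasible Sx0 Sw0 rx rw"
      "\<And>Sx' Sw'. (Sx', Sw') \<in> feasible Sx0 Sw0 rx rw \<Longrightarrow> mmse_obj H Sx' Sw' \<le> mmse_obj H Sx Sw"
      "loewner_ge Sx (lambda_min Sx0 *\<^sub>R mat 1)" "loewner_ge Sw (lambda_min Sw0 *\<^sub>R mat 1)"
      using mmse_obj_maximizer [OF assms(1) Sw0 assms(3,4), of H] by blast
    have "ereal (mmse_obj H Sx Sw) = (SUP S\<in>feasible Sx0 Sw0 rx rw. ereal (mmse_obj H (fst S) (snd S)))"
    proof (rule antisym)
      show "ereal (mmse_obj H Sx Sw) \<le> (SUP S\<in>feasible Sx0 Sw0 rx rw. ereal (mmse_obj H (fst S) (snd S)))"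
        by (rule SUP_upper2 [OF S(1)]) simp
      show "(SUP S\<in>feasible Sx0 Sw0 rx rw. ereal (mmse_obj H (fst S) (snd S))) \<le> ereal (mmse_obj H Sx Sw)"
        by (rule SUP_least) (use S(2) in auto)
    qed
    with S show ?thesis by blast
  qed
  have "gauss mux Sx \<Otimes>\<^sub>M gauss muw Sw \<in> normal_ambiguity_set mux Sx0 muw Sw0 rx rw"
    if "(Sx, Sw) \<in> feasible Sx0 Sw0 rx rw" for Sx Sw
    unfolding normal_ambiguity_set_eq [OF assms] using that by (rule rev_image_eqI) simp
  with eq solvable INF_eq show ?thesis by simp
qed

end
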